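(* Let $N$ be an $A$-definable normal subgroup of $G$. For each $\mu\in H^1_{\mathrm{def}}(\mathcal G,G)$ there is a natural surjective morphism of pointed sets from $H^1_{\mathrm{def}}(\mathcal G_\mu,N)$ to the fibre $\mathfrak P(\mu)=(\pi^1)^{-1}(\pi^1(\mu))$, where $\mathfrak P(\mu)$ has distinguished element $\mu$.
   Context: Setting. Fix a first-order structure $M$ and a subset $A$ of $M$ such that: (i) $M$ is atomic over $A$, i.e. for every finite tuple $a$ from $M$ the type $\mathrm{tp}(a/A)$ is isolated; (ii) for all finite tuples $a,b$ from $M$ with $\mathrm{tp}(a/A)=\mathrm{tp}(b/A)$ there is $\sigma\in\mathrm{Aut}(M/A)$ with $\sigma(a)=b$; (iii) the theory of $M$ eliminates imaginaries (so $G/N$ is identified with an $A$-definable group). Put $\mathcal G=\mathrm{Aut}(M/A)$. $G$ is an arbitrary group definable in $M$ with parameters from $A$; $\mathcal G$ acts on $G$ by group automorphisms. "$A$-definable" means definable in $M$ with parameters from $A$. Tuples are finite. Definable cohomology. For an $A$-definable group $G$, a definable cocycle from $\mathcal G$ to $G$ is a map $\Phi:\mathcal G\to G$ with $\Phi(\sigma_1\sigma_2)=\Phi(\sigma_1)\cdot\sigma_1(\Phi(\sigma_2))$ for which there are a tuple $a$ from $M$ and an $A$-definable (partial) function $h(x,y)$ with $\Phi(\sigma)=h(a,\sigma(a))$ for all $\sigma\in\mathcal G$. The set of these is $Z^1_{\mathrm{def}}(\mathcal G,G)$. $\Phi$ and $\Psi$ are cohomologous if there is $b\in G$ with $\Psi(\sigma)=b^{-1}\Phi(\sigma)\sigma(b)$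 for all $\sigma$. $H^1_{\mathrm{def}}(\mathcal G,G)$ is the set of equivalence classes, pointed by the class of the trivial cocycle. Let $\pi:G\to G/N$ be the projection and $\pi^1:H^1_{\mathrm{def}}(\mathcal G,G)\to H^1_{\mathrm{def}}(\mathcal G,G/N)$, $[\Phi]\mapsto[\pi\circ\Phi]$. Twisting. Let $\Phi\in Z^1_{\mathrm{def}}(\mathcal G,G)$ have cohomology class $\mu$. The twisted action of $\mathcal G$ on $N$ is $\sigma*n=\Phi(\sigma)\,\sigma(n)\,\Phi(\sigma)^{-1}$; write $\mathcal G_\Phi$ for $\mathcal G$ with this action. $Z^1_{\mathrm{def}}(\mathcal G_\Phi,N)$ is the set of maps $\Psi:\mathcal G\to N$ with $\Psi(\sigma_1\sigma_2)=\Psi(\sigma_1)\cdot(\sigma_1*\Psi(\sigma_2))$ that are definable (i.e. $\Psi(\sigma)=h(a,\sigma(a))$ for all $\sigma\in\mathcal G$, for some tuple $a$ from $M$ and $A$-definable function $h$). $\Psi,\Lambda$ are cohomologous if there is $b\in N$ with $\Psi(\sigma)=b^{-1}\Lambda(\sigma)(\sigma*b)$ for all $\sigma$. $H^1_{\mathrm{def}}(\mathcal G_\Phi,N)$ is the set of classes, pointed by the class of the trivial cocycle. Up to natural isomorphism of pointed sets it depends only on $\mu$, and it is denoted $H^1_{\mathrm{def}}(\mathcal G_\mu,N)$ (computed with any $\Phi$ of class $\mu$). "Natural" refers to the map sending the class of $\Psi$ to the class in $H^1_{\mathrm{def}}(\mathcal G,G)$ of the cocycle $\sigma\mapsto\Psi(\sigma)\cdot\Phi(\sigma)$.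 *)

theory Defs
  imports "HOL-Algebra.Coset"
begin

text \<open>The universe of a structure is the whole type \<open>'m\<close>. A symbol is a name together with an
  arity, so the interpretation of \<open>f\<close> matters only on lists of length \<open>l\<close> with
  \<open>(f, l) \<in> fun_syms S\<close>; likewise for relation symbols.\<close>

record ('f, 'r, 'm) fo_struct =
  fun_syms :: "('f \<times> nat) set"
  rel_syms :: "('r \<times> nat) set"
  fun_int :: "'f \<Rightarrow> 'm list \<Rightarrow> 'm"
  rel_int :: "'r \<Rightarrow> 'm list \<Rightarrow> bool"

datatype ('f, 'm) fo_term = Var nat | Par 'm | App 'f "('f, 'm) fo_term list"

text \<open>De Bruijn indices: \<open>Ex\<close> binds variable \<open>0\<close> and shifts the others, so that evaluation conses
  the witness onto the environment.\<close>

datatype ('f, 'r, 'm) fo_form =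
    Eql "('f, 'm) fo_term" "('f, 'm) fo_term"
  | Rel 'r "('f, 'm) fo_term list"
  | Neg "('f, 'r, 'm) fo_form"
  | Conj "('f, 'r, 'm) fo_form" "('f, 'r, 'm) fo_form"
  | Ex "('f, 'r, 'm) fo_form"

text \<open>\<open>is_form S A n \<phi>\<close>: \<open>\<phi>\<close> is a formula of the language of \<open>S\<close> with parameters from \<open>A\<close> whose free
  variables are among the first \<open>n\<close>.\<close>

fun is_term :: "('f, 'r, 'm) fo_struct \<Rightarrow> 'm set \<Rightarrow> nat \<Rightarrow> ('f, 'm) fo_term \<Rightarrow> bool" where
  "is_term S A n (Var i) \<longleftrightarrow> i < n"
| "is_term S A n (Par c) \<longleftrightarrow> c \<in> A"
| "is_term S A n (App f ts) \<longleftrightarrow> (f, length ts) \<in> fun_syms S \<and> (\<forall>t \<in> set ts. is_term S A n t)"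

fun is_form :: "('f, 'r, 'm) fo_struct \<Rightarrow> 'm set \<Rightarrow> nat \<Rightarrow> ('f, 'r, 'm) fo_form \<Rightarrow> bool" where
  "is_form S A n (Eql s t) \<longleftrightarrow> is_term S A n s \<and> is_term S A n t"
| "is_form S A n (Rel r ts) \<longleftrightarrow> (r, length ts) \<in> rel_syms S \<and> (\<forall>t \<in> set ts. is_term S A n t)"
| "is_form S A n (Neg \<phi>) \<longleftrightarrow> is_form S A n \<phi>"
| "is_form S A n (Conj \<phi> \<psi>) \<longleftrightarrow> is_form S A n \<phi> \<and> is_form S A n \<psi>"
| "is_form S A n (Ex \<phi>) \<longleftrightarrow> is_form S A (Suc n) \<phi>"

fun eval_term :: "('f, 'r, 'm) fo_struct \<Rightarrow> 'm list \<Rightarrow> ('f, 'm) fo_term \<Rightarrow> 'm" where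
  "eval_term S e (Var i) = e ! i"
| "eval_term S e (Par c) = c"
| "eval_term S e (App f ts) = fun_int S f (map (eval_term S e) ts)"

fun sat :: "('f, 'r, 'm) fo_struct \<Rightarrow> 'm list \<Rightarrow> ('f, 'r, 'm) fo_form \<Rightarrow> bool" where
  "sat S e (Eql s t) \<longleftrightarrow> eval_term S e s = eval_term S e t"
| "sat S e (Rel r ts) \<longleftrightarrow> rel_int S r (map (eval_term S e) ts)"
| "sat S e (Neg \<phi>) \<longleftrightarrow> \<not> sat S e \<phi>"
| "sat S e (Conj \<phi> \<psi>) \<longleftrightarrow> sat S e \<phi> \<and> sat S e \<psi>"
| "sat S e (Ex \<phi>) \<longleftrightarrow> (\<exists>m. sat S (m # e) \<phi>)"

definition tuples :: "nat \<Rightarrow> 'm list set" where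
  "tuples n = {a. length a = n}"

definition definable :: "('f, 'r, 'm) fo_struct \<Rightarrow> 'm set \<Rightarrow> nat \<Rightarrow> 'm list set \<Rightarrow> bool" where
  "definable S A n X \<longleftrightarrow> (\<exists>\<phi>. is_form S A n \<phi> \<and> X = {a \<in> tuples n. sat S a \<phi>})"

definition definable_pfun ::
  "('f, 'r, 'm) fo_struct \<Rightarrow> 'm set \<Rightarrow> nat \<Rightarrow> nat \<Rightarrow> ('m list \<rightharpoonup> 'm list) \<Rightarrow> bool" where
  "definable_pfun S A k n h \<longleftrightarrow>
     dom h \<subseteq> tuples k \<and> ran h \<subseteq> tuples n \<and> definable S A (k + n) {x @ y | x y. h x = Some y}"

definition tp :: "('f, 'r, 'm) fo_struct \<Rightarrow> 'm set \<Rightarrow> 'm list \<Rightarrow> ('f, 'r, 'm) fo_form set" where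
  "tp S A a = {\<phi>. is_form S A (length a) \<phi> \<and> sat S a \<phi>}"

text \<open>Isolation of \<open>p\<close> means that some \<open>\<phi> \<in> p\<close> implies every \<open>\<psi> \<in> p\<close> modulo the theory of
  \<open>S\<close> with names for \<open>A\<close>; that theory is complete, so implication is tested in \<open>S\<close> itself.\<close>

definition isolated_type ::
  "('f, 'r, 'm) fo_struct \<Rightarrow> nat \<Rightarrow> ('f, 'r, 'm) fo_form set \<Rightarrow> bool" where
  "isolated_type S n p \<longleftrightarrow> (\<exists>\<phi> \<in> p. \<forall>\<psi> \<in> p. \<forall>b \<in> tuples n. sat S b \<phi> \<longrightarrow> sat S b \<psi>)"

definition atomic_over :: "('f, 'r, 'm) fo_struct \<Rightarrow> 'm set \<Rightarrow> bool" where
  "atomic_over S A \<longleftrightarrow> (\<forall>a. isolated_type S (length a) (tp S A a))"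

definition Aut :: "('f, 'r, 'm) fo_struct \<Rightarrow> 'm set \<Rightarrow> ('m \<Rightarrow> 'm) set" where
  "Aut S A = {\<sigma>. bij \<sigma>
     \<and> (\<forall>(f, l) \<in> fun_syms S. \<forall>a \<in> tuples l. \<sigma> (fun_int S f a) = fun_int S f (map \<sigma> a))
     \<and> (\<forall>(r, l) \<in> rel_syms S. \<forall>a \<in> tuples l. rel_int S r a \<longleftrightarrow> rel_int S r (map \<sigma> a))
     \<and> (\<forall>c \<in> A. \<sigma> c = c)}"

definition homogeneous_over :: "('f, 'r, 'm) fo_struct \<Rightarrow> 'm set \<Rightarrow> bool" where
  "homogeneous_over S A \<longleftrightarrow>
     (\<forall>a b. length a = length b \<and> tp S A a = tp S A b \<longrightarrow> (\<exists>\<sigma> \<in> Aut S A. map \<sigma> a = b))"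

text \<open>Elimination of imaginaries of the theory of \<open>S\<close>, in the form that makes every definable
  quotient a definable set: each \<open>\<emptyset>\<close>-definable equivalence relation on \<open>n\<close>-tuples is the
  kernel of an \<open>\<emptyset>\<close>-definable function. That given formulas define an equivalence relation and
  such a function is expressed by a first-order sentence, so this depends only on the theory of
  \<open>S\<close>.\<close>

definition eliminates_imaginaries :: "('f, 'r, 'm) fo_struct \<Rightarrow> bool" where
  "eliminates_imaginaries S \<longleftrightarrow>
     (\<forall>n E. equiv (tuples n) E
        \<and> definable S {} (n + n) {x @ y | x y. (x, y) \<in> E} \<longrightarrow>
        (\<exists>k f. definable_pfun S {} n k f \<and> dom f = tuples n
           \<and> (\<forall>x \<in> tuples n. \<forall>y \<in> tuples n. (x, y) \<in> E \<longleftrightarrow> f x = f y)))"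

definition definable_group ::
  "('f, 'r, 'm) fo_struct \<Rightarrow> 'm set \<Rightarrow> nat \<Rightarrow> 'm list monoid \<Rightarrow> bool" where
  "definable_group S A n G \<longleftrightarrow>
     group G \<and> definable S A n (carrier G)
     \<and> definable S A (n + n + n)
         {x @ y @ (x \<otimes>\<^bsub>G\<^esub> y) | x y. x \<in> carrier G \<and> y \<in> carrier G}"

text \<open>\<open>\<iota>\<close> identifies the quotient group \<open>G Mod N\<close> with the \<open>A\<close>-definable group \<open>Q\<close> in such a way
  that the projection \<open>quot_proj G N \<iota>\<close> of \<open>G\<close> onto \<open>Q\<close> is \<open>A\<close>-definable.\<close>

definition quot_proj ::
  "'m list monoid \<Rightarrow> 'm list set \<Rightarrow> ('m list set \<Rightarrow> 'm list) \<Rightarrow> 'm list \<Rightarrow> 'm list" where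
  "quot_proj G N \<iota> x = \<iota> (N #>\<^bsub>G\<^esub> x)"

definition definable_quotient ::
  "('f, 'r, 'm) fo_struct \<Rightarrow> 'm set \<Rightarrow> nat \<Rightarrow> 'm list monoid \<Rightarrow> 'm list set
     \<Rightarrow> nat \<Rightarrow> 'm list monoid \<Rightarrow> ('m list set \<Rightarrow> 'm list) \<Rightarrow> bool" where
  "definable_quotient S A n G N k Q \<iota> \<longleftrightarrow>
     definable_group S A k Q \<and> \<iota> \<in> iso (G Mod N) Q
     \<and> definable S A (n + k) {x @ quot_proj G N \<iota> x | x. x \<in> carrier G}"

definition definable_cochain ::
  "('f, 'r, 'm) fo_struct \<Rightarrow> 'm set \<Rightarrow> (('m \<Rightarrow> 'm) \<Rightarrow> 'm list) \<Rightarrow> bool" where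
  "definable_cochain S A \<Phi> \<longleftrightarrow>
     (\<exists>a n h. definable_pfun S A (length a + length a) n h
        \<and> (\<forall>\<sigma> \<in> Aut S A. h (a @ map \<sigma> a) = Some (\<Phi> \<sigma>)))"

text \<open>The parameter \<open>act\<close> is the action of \<open>Aut S A\<close> on \<open>G\<close>: it is \<open>map\<close> for the natural coordinatewise
  action and \<open>twist G \<Phi>\<close> below for the action twisted by a cocycle. Cocycles are extensional
  functions on \<open>Aut S A\<close>.\<close>

definition Z1 ::
  "('f, 'r, 'm) fo_struct \<Rightarrow> 'm set \<Rightarrow> 'm list monoid \<Rightarrow> (('m \<Rightarrow> 'm) \<Rightarrow> 'm list \<Rightarrow> 'm list)
     \<Rightarrow> (('m \<Rightarrow> 'm) \<Rightarrow> 'm list) set" where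
  "Z1 S A G act = {\<Phi> \<in> Aut S A \<rightarrow>\<^sub>E carrier G.
     (\<forall>\<sigma> \<in> Aut S A. \<forall>\<tau> \<in> Aut S A. \<Phi> (\<sigma> \<circ> \<tau>) = \<Phi> \<sigma> \<otimes>\<^bsub>G\<^esub> act \<sigma> (\<Phi> \<tau>))
     \<and> definable_cochain S A \<Phi>}"

definition cohomologous ::
  "('f, 'r, 'm) fo_struct \<Rightarrow> 'm set \<Rightarrow> 'm list monoid \<Rightarrow> (('m \<Rightarrow> 'm) \<Rightarrow> 'm list \<Rightarrow> 'm list)
     \<Rightarrow> (('m \<Rightarrow> 'm) \<Rightarrow> 'm list) rel" where
  "cohomologous S A G act = {(\<Phi>, \<Psi>). \<Phi> \<in> Z1 S A G act \<and> \<Psi> \<in> Z1 S A G act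
     \<and> (\<exists>b \<in> carrier G. \<forall>\<sigma> \<in> Aut S A. \<Psi> \<sigma> = inv\<^bsub>G\<^esub> b \<otimes>\<^bsub>G\<^esub> \<Phi> \<sigma> \<otimes>\<^bsub>G\<^esub> act \<sigma> b)}"

definition H1 ::
  "('f, 'r, 'm) fo_struct \<Rightarrow> 'm set \<Rightarrow> 'm list monoid \<Rightarrow> (('m \<Rightarrow> 'm) \<Rightarrow> 'm list \<Rightarrow> 'm list)
     \<Rightarrow> (('m \<Rightarrow> 'm) \<Rightarrow> 'm list) set set" where
  "H1 S A G act = Z1 S A G act // cohomologous S A G act"

definition coh_class ::
  "('f, 'r, 'm) fo_struct \<Rightarrow> 'm set \<Rightarrow> 'm list monoid \<Rightarrow> (('m \<Rightarrow> 'm) \<Rightarrow> 'm list \<Rightarrow> 'm list)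
     \<Rightarrow> (('m \<Rightarrow> 'm) \<Rightarrow> 'm list) \<Rightarrow> (('m \<Rightarrow> 'm) \<Rightarrow> 'm list) set" where
  "coh_class S A G act \<Phi> = cohomologous S A G act `` {\<Phi>}"

definition trivial_class ::
  "('f, 'r, 'm) fo_struct \<Rightarrow> 'm set \<Rightarrow> 'm list monoid \<Rightarrow> (('m \<Rightarrow> 'm) \<Rightarrow> 'm list \<Rightarrow> 'm list)
     \<Rightarrow> (('m \<Rightarrow> 'm) \<Rightarrow> 'm list) set" where
  "trivial_class S A G act = coh_class S A G act (\<lambda>\<sigma> \<in> Aut S A. \<one>\<^bsub>G\<^esub>)"

definition twist ::
  "'m list monoid \<Rightarrow> (('m \<Rightarrow> 'm) \<Rightarrow> 'm list) \<Rightarrow> ('m \<Rightarrow> 'm) \<Rightarrow> 'm list \<Rightarrow> 'm list" where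
  "twist G \<Phi> \<sigma> x = \<Phi> \<sigma> \<otimes>\<^bsub>G\<^esub> map \<sigma> x \<otimes>\<^bsub>G\<^esub> inv\<^bsub>G\<^esub> (\<Phi> \<sigma>)"

text \<open>The map on cohomology induced by \<open>\<pi> : G \<rightarrow> Q\<close>, namely \<open>[\<Phi>] \<mapsto> [\<pi> \<circ> \<Phi>]\<close>; the union
  is over equal sets, by compatibility of \<open>\<pi> \<circ> _\<close> with the equivalence relations.\<close>

definition H1_map ::
  "('f, 'r, 'm) fo_struct \<Rightarrow> 'm set \<Rightarrow> 'm list monoid \<Rightarrow> ('m list \<Rightarrow> 'm list)
     \<Rightarrow> (('m \<Rightarrow> 'm) \<Rightarrow> 'm list) set \<Rightarrow> (('m \<Rightarrow> 'm) \<Rightarrow> 'm list) set" where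
  "H1_map S A Q \<pi> \<mu> = (\<Union>\<Phi> \<in> \<mu>. coh_class S A Q map (\<lambda>\<sigma> \<in> Aut S A. \<pi> (\<Phi> \<sigma>)))"

definition H1_fibre ::
  "('f, 'r, 'm) fo_struct \<Rightarrow> 'm set \<Rightarrow> 'm list monoid \<Rightarrow> 'm list monoid \<Rightarrow> ('m list \<Rightarrow> 'm list)
     \<Rightarrow> (('m \<Rightarrow> 'm) \<Rightarrow> 'm list) set \<Rightarrow> (('m \<Rightarrow> 'm) \<Rightarrow> 'm list) set set" where
  "H1_fibre S A G Q \<pi> \<mu> = {\<nu> \<in> H1 S A G map. H1_map S A Q \<pi> \<nu> = H1_map S A Q \<pi> \<mu>}"

definition pointed_morphism :: "'a set \<Rightarrow> 'a \<Rightarrow> 'b set \<Rightarrow> 'b \<Rightarrow> ('a \<Rightarrow> 'b) \<Rightarrow> bool" where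
  "pointed_morphism X x Y y F \<longleftrightarrow> x \<in> X \<and> y \<in> Y \<and> F \<in> X \<rightarrow> Y \<and> F x = y"

end

theory Submission
  imports Defs
begin

text \<open>
  Fix a cocycle \<open>\<Phi>\<close> of class \<open>\<mu>\<close>. The twisted action of \<open>\<sigma>\<close> on \<open>N\<close> is the natural one followed by
  conjugation by \<open>\<Phi> \<sigma>\<close>, and this is exactly what makes \<open>\<sigma> \<mapsto> \<Psi> \<sigma> \<cdot> \<Phi> \<sigma>\<close> a cocycle with values in \<open>G\<close>
  when \<open>\<Psi>\<close> is a twisted cocycle with values in \<open>N\<close> (\<open>translate_cocycle\<close>). A coboundary \<open>b \<in> N\<close> between
  twisted cocycles is a coboundary between the products, so the construction passes to classes
  (\<open>translate_cohomologous\<close>). Since \<open>\<Psi>\<close> has values in \<open>N\<close>, the projection to \<open>G/N\<close> sees only \<open>\<Phi>\<close>, so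
  the product lies in the fibre of \<open>\<mu>\<close>; the trivial \<open>\<Psi>\<close> yields \<open>\<mu>\<close> itself.

  For surjectivity (\<open>fibre_lift\<close>), let \<open>\<Lambda>\<close> have a projection cohomologous to that of \<open>\<Phi>\<close> through \<open>c\<close>, and
  lift \<open>c\<close> to \<open>b \<in> G\<close>. Replacing \<open>\<Lambda>\<close> by the cohomologous cocycle \<open>b \<cdot> \<Lambda> \<sigma> \<cdot> \<sigma>(b)\<inverse>\<close> makes both projections
  equal, and then \<open>\<Psi> \<sigma> = b \<cdot> \<Lambda> \<sigma> \<cdot> \<sigma>(b)\<inverse> \<cdot> (\<Phi> \<sigma>)\<inverse>\<close> has values in \<open>N\<close>, is a twisted cocycle and is sent to
  the class of \<open>\<Lambda>\<close>.

  Three facts about definability support this computation. Automorphisms over \<open>A\<close> preserve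
  \<open>A\<close>-definable sets (\<open>definable_Aut\<close>), so they act by automorphisms on definable groups and commute with the
  projection. Definable cochains are closed under product, division and composition with definable
  maps, and the cochains \<open>\<sigma> \<mapsto> b\<close> and \<open>\<sigma> \<mapsto> \<sigma>(b)\<close> are definable; the point is that if \<open>\<Phi> \<sigma>\<close> is computed
  from \<open>a, \<sigma>(a)\<close> and \<open>\<Psi> \<sigma>\<close> from \<open>b, \<sigma>(b)\<close>, then both are computed from \<open>ab, \<sigma>(ab)\<close>
  (\<open>definable_cochain_combine\<close>). Finally, the quotient is a definable group: the cosets \<open>N x\<close> are the
  fibres of an \<open>A\<close>-definable family, and elimination of imaginaries assigns to \<open>x\<close> a tuple that depends
  only on its fibre and determines it (\<open>definable_family_classifier\<close>).
\<close>

section \<open>Substitution in formulas\<close>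

text \<open>Both variables and parameters are substituted. The same operation then serves to rename the
  variables of a formula, to put parameters in place of variables, and to turn parameters into variables.\<close>

fun subst_term ::
  "(nat \<Rightarrow> ('f, 'm) fo_term) \<Rightarrow> ('m \<Rightarrow> ('f, 'm) fo_term) \<Rightarrow> ('f, 'm) fo_term \<Rightarrow> ('f, 'm) fo_term"
where
  "subst_term v p (Var i) = v i"
| "subst_term v p (Par c) = p c"
| "subst_term v p (App f ts) = App f (map (subst_term v p) ts)"

definition shift_term :: "('f, 'm) fo_term \<Rightarrow> ('f, 'm) fo_term" where
  "shift_term = subst_term (\<lambda>i. Var (Suc i)) Par"

fun subst_form ::
  "(nat \<Rightarrow> ('f, 'm) fo_term) \<Rightarrow> ('m \<Rightarrow> ('f, 'm) fo_term) \<Rightarrow> ('f, 'r, 'm) fo_form \<Rightarrow> ('f, 'r, 'm) fo_form"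
where
  "subst_form v p (Eql s t) = Eql (subst_term v p s) (subst_term v p t)"
| "subst_form v p (Rel r ts) = Rel r (map (subst_term v p) ts)"
| "subst_form v p (Neg \<phi>) = Neg (subst_form v p \<phi>)"
| "subst_form v p (Conj \<phi> \<psi>) = Conj (subst_form v p \<phi>) (subst_form v p \<psi>)"
| "subst_form v p (Ex \<phi>) =
     Ex (subst_form (case_nat (Var 0) (\<lambda>i. shift_term (v i))) (\<lambda>c. shift_term (p c)) \<phi>)"

lemma is_term_subst:
  assumes "is_term S A n t" "\<And>i. i < n \<Longrightarrow> is_term S B k (v i)" "\<And>c. c \<in> A \<Longrightarrow> is_term S B k (p c)"
  shows "is_term S B k (subst_term v p t)"
  using assms by (induction t) auto

lemma eval_subst:
  assumes "is_term S A n t" "\<And>i. i < n \<Longrightarrow> eval_term S d (v i) = e ! i"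
    "\<And>c. c \<in> A \<Longrightarrow> eval_term S d (p c) = c"
  shows "eval_term S d (subst_term v p t) = eval_term S e t"
  using assms
proof (induction t)
  case (App f ts)
  then have "map (eval_term S d \<circ> subst_term v p) ts = map (eval_term S e) ts" by auto
  then show ?case by (simp only: subst_term.simps eval_term.simps map_map)
qed auto

lemma is_term_shift: "is_term S A n t \<Longrightarrow> is_term S A (Suc n) (shift_term t)"
  unfolding shift_term_def by (rule is_term_subst) auto

lemma eval_shift [simp]: "eval_term S (m # e) (shift_term t) = eval_term S e t"
proof (induction t)
  case (App f ts)
  then have "map (eval_term S (m # e) \<circ> shift_term) ts = map (eval_term S e) ts" by auto
  then show ?case by (simp only: shift_term_def subst_term.simps eval_term.simps map_map)
qed (auto simp: shift_term_def)

lemma is_form_subst: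
  assumes "is_form S A n \<phi>" "\<And>i. i < n \<Longrightarrow> is_term S B k (v i)" "\<And>c. c \<in> A \<Longrightarrow> is_term S B k (p c)"
  shows "is_form S B k (subst_form v p \<phi>)"
  using assms
proof (induction \<phi> arbitrary: n k v p)
  case (Ex \<phi>)
  show ?case unfolding subst_form.simps is_form.simps
    by (rule Ex.IH[of "Suc n"])
      (use Ex.prems in \<open>auto simp: is_term_shift split: nat.split\<close>)
next
  case (Conj \<phi> \<psi>)
  show ?case using Conj.IH(1)[of n] Conj.IH(2)[of n] Conj.prems by simp
next
  case (Neg \<phi>)
  show ?case using Neg.IH[of n] Neg.prems by simp
qed (auto intro: is_term_subst)

text \<open>The parameter values are compared only on \<open>A\<close>, and the environments only on the \<open>n\<close> variables that may
  occur; this is what allows an environment to be extended by entries standing for parameters.\<close>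

lemma sat_subst:
  assumes "is_form S A n \<phi>" "\<And>i. i < n \<Longrightarrow> eval_term S d (v i) = e ! i"
    "\<And>c. c \<in> A \<Longrightarrow> eval_term S d (p c) = c"
  shows "sat S d (subst_form v p \<phi>) \<longleftrightarrow> sat S e \<phi>"
  using assms
proof (induction \<phi> arbitrary: n d e v p)
  case (Ex \<phi>)
  have "sat S (m # d) (subst_form (case_nat (Var 0) (\<lambda>i. shift_term (v i))) (\<lambda>c. shift_term (p c)) \<phi>)
      \<longleftrightarrow> sat S (m # e) \<phi>" for m
    by (rule Ex.IH[of "Suc n"]) (use Ex.prems in \<open>auto split: nat.split\<close>)
  then show ?case by simp
next
  case (Conj \<phi> \<psi>)
  show ?case using Conj.IH(1)[of n d v e p] Conj.IH(2)[of n d v e p] Conj.prems by simp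
next
  case (Neg \<phi>)
  show ?case using Neg.IH[of n d v e p] Neg.prems by simp
next
  case (Rel r ts)
  then have "map (eval_term S d \<circ> subst_term v p) ts = map (eval_term S e) ts"
    by (auto intro: eval_subst)
  then show ?case by (simp only: subst_form.simps sat.simps map_map)
next
  case (Eql s t)
  then show ?case using eval_subst[of S A n s d v e p] eval_subst[of S A n t d v e p] by simp
qed

lemma is_term_mono: "is_term S A n t \<Longrightarrow> A \<subseteq> B \<Longrightarrow> is_term S B n t"
  by (induction t) auto

lemma is_form_mono: "is_form S A n \<phi> \<Longrightarrow> A \<subseteq> B \<Longrightarrow> is_form S B n \<phi>"
  by (induction \<phi> arbitrary: n) (auto intro: is_term_mono)

lemma terms_finite_params:
  assumes "\<And>t. t \<in> set ts \<Longrightarrow> \<exists>B. finite B \<and> B \<subseteq> A \<and> is_term S B n t"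
  shows "\<exists>B. finite B \<and> B \<subseteq> A \<and> (\<forall>t \<in> set ts. is_term S B n t)"
proof -
  obtain B where "\<And>t. t \<in> set ts \<Longrightarrow> finite (B t) \<and> B t \<subseteq> A \<and> is_term S (B t) n t"
    using assms by metis
  then show ?thesis
    by (intro exI[of _ "\<Union>t \<in> set ts. B t"]) (auto intro: is_term_mono)
qed

lemma is_term_finite_params:
  "is_term S A n t \<Longrightarrow> \<exists>B. finite B \<and> B \<subseteq> A \<and> is_term S B n t"
proof (induction t)
  case (App f ts)
  then have "\<exists>B. finite B \<and> B \<subseteq> A \<and> (\<forall>t \<in> set ts. is_term S B n t)"
    by (intro terms_finite_params) simp
  then show ?case using App.prems by simp
next
  case (Par c)
  then show ?case by (intro exI[of _ "{c}"]) auto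
next
  case (Var i)
  then show ?case by (intro exI[of _ "{}"]) auto
qed

text \<open>A formula is a finite object. With this its parameters can be listed in one finite tuple, over
  which one can then quantify.\<close>

lemma is_form_finite_params:
  "is_form S A n \<phi> \<Longrightarrow> \<exists>B. finite B \<and> B \<subseteq> A \<and> is_form S B n \<phi>"
proof (induction \<phi> arbitrary: n)
  case (Eql s t)
  then obtain B C where "finite B" "B \<subseteq> A" "is_term S B n s" "finite C" "C \<subseteq> A" "is_term S C n t"
    by (meson is_form.simps(1) is_term_finite_params)
  then show ?case by (intro exI[of _ "B \<union> C"]) (auto intro: is_term_mono)
next
  case (Rel r ts)
  then have "\<exists>B. finite B \<and> B \<subseteq> A \<and> (\<forall>t \<in> set ts. is_term S B n t)"
    using terms_finite_params[of ts A S n] is_term_finite_params[of S A n] by simp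
  then show ?case using Rel.prems by simp
next
  case (Conj \<phi> \<psi>)
  then obtain B C where "finite B" "B \<subseteq> A" "is_form S B n \<phi>" "finite C" "C \<subseteq> A" "is_form S C n \<psi>"
    by (meson is_form.simps(4))
  then show ?case by (intro exI[of _ "B \<union> C"]) (auto intro: is_form_mono)
qed simp_all

section \<open>Closure properties of definable sets\<close>

lemma definable_tuples: "definable S A n X \<Longrightarrow> X \<subseteq> tuples n"
  unfolding definable_def by auto

lemma definable_mono: "definable S A n X \<Longrightarrow> A \<subseteq> B \<Longrightarrow> definable S B n X"
  unfolding definable_def using is_form_mono by blast

lemma definable_Compl:
  assumes "definable S A n X"
  shows "definable S A n (tuples n - X)"
proof -
  obtain \<phi> where "is_form S A n \<phi>" "X = {a \<in> tuples n. sat S a \<phi>}"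
    using assms unfolding definable_def by blast
  then show ?thesis unfolding definable_def by (intro exI[of _ "Neg \<phi>"]) auto
qed

lemma definable_Int:
  assumes "definable S A n X" "definable S A n Y"
  shows "definable S A n (X \<inter> Y)"
proof -
  obtain \<phi> \<psi> where "is_form S A n \<phi>" "X = {a \<in> tuples n. sat S a \<phi>}"
    "is_form S A n \<psi>" "Y = {a \<in> tuples n. sat S a \<psi>}"
    using assms unfolding definable_def by blast
  then show ?thesis unfolding definable_def by (intro exI[of _ "Conj \<phi> \<psi>"]) auto
qed

text \<open>The quantifier consumes the first entry of the environment, so a block of \<open>k\<close> leading entries is
  projected away by \<open>k\<close> quantifiers.\<close>

lemma definable_projection:
  assumes "definable S A (k + n) X"
  shows "definable S A n {a \<in> tuples n. \<exists>u \<in> tuples k. u @ a \<in> X}"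
  using assms
proof (induction k arbitrary: X)
  case 0
  then have "{a \<in> tuples n. \<exists>u \<in> tuples 0. u @ a \<in> X} = X"
    using definable_tuples[of S A n X] by (auto simp: tuples_def)
  then show ?case using 0 by simp
next
  case (Suc k)
  obtain \<phi> where \<phi>: "is_form S A (Suc (k + n)) \<phi>" "X = {a \<in> tuples (Suc (k + n)). sat S a \<phi>}"
    using Suc.prems unfolding definable_def by auto
  let ?Y = "{b \<in> tuples (k + n). \<exists>m. m # b \<in> X}"
  have "definable S A (k + n) ?Y"
    unfolding definable_def using \<phi> by (intro exI[of _ "Ex \<phi>"]) (auto simp: tuples_def)
  moreover have "(\<exists>u \<in> tuples (Suc k). u @ a \<in> X) \<longleftrightarrow> (\<exists>u \<in> tuples k. u @ a \<in> ?Y)"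
    if "a \<in> tuples n" for a
  proof
    assume "\<exists>u \<in> tuples (Suc k). u @ a \<in> X"
    then obtain m u where "length u = k" "(m # u) @ a \<in> X"
      by (auto simp: tuples_def length_Suc_conv)
    then show "\<exists>u \<in> tuples k. u @ a \<in> ?Y"
      using that by (intro bexI[of _ u]) (auto simp: tuples_def)
  next
    assume "\<exists>u \<in> tuples k. u @ a \<in> ?Y"
    then obtain m u where "length u = k" "(m # u) @ a \<in> X" by (auto simp: tuples_def)
    then show "\<exists>u \<in> tuples (Suc k). u @ a \<in> X"
      by (intro bexI[of _ "m # u"]) (auto simp: tuples_def)
  qed
  then have "{a \<in> tuples n. \<exists>u \<in> tuples (Suc k). u @ a \<in> X} = {a \<in> tuples n. \<exists>u \<in> tuples k. u @ a \<in> ?Y}"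
    by blast
  ultimately show ?case using Suc.IH[of ?Y] by (simp only:)
qed

text \<open>Preimages of definable sets under tuples of terms. Coordinate changes and the insertion of parameters
  are the special cases used below.\<close>

lemma definable_subst:
  assumes "definable S A k X" "\<And>i. i < k \<Longrightarrow> is_term S A n (t i)"
  shows "definable S A n {a \<in> tuples n. map (\<lambda>i. eval_term S a (t i)) [0..<k] \<in> X}"
proof -
  obtain \<phi> where \<phi>: "is_form S A k \<phi>" "X = {a \<in> tuples k. sat S a \<phi>}"
    using assms unfolding definable_def by blast
  have "is_form S A n (subst_form t Par \<phi>)"
    using \<phi>(1) assms(2) by (rule is_form_subst) auto
  moreover have "sat S a (subst_form t Par \<phi>) \<longleftrightarrow> sat S (map (\<lambda>i. eval_term S a (t i)) [0..<k]) \<phi>"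
    for a using \<phi>(1) by (rule sat_subst) auto
  ultimately show ?thesis unfolding definable_def \<phi>(2)
    by (intro exI[of _ "subst_form t Par \<phi>"]) (auto simp: tuples_def)
qed

lemma definable_reindex:
  assumes "definable S A k X" "length js = k" "\<And>j. j \<in> set js \<Longrightarrow> j < n"
  shows "definable S A n {a \<in> tuples n. map ((!) a) js \<in> X}"
proof -
  have "map (\<lambda>i. eval_term S a (Var (js ! i))) [0..<k] = map ((!) a) js" for a
    using assms(2) by (auto intro: nth_equalityI)
  then show ?thesis
    using definable_subst[OF assms(1), of n "\<lambda>i. Var (js ! i)"] assms(2,3) by simp
qed

lemma definable_fix_params:
  assumes "definable S A (n + length c) X" "set c \<subseteq> A"
  shows "definable S A n {a \<in> tuples n. a @ c \<in> X}"
proof -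
  let ?t = "\<lambda>i. if i < n then Var i else Par (c ! (i - n))"
  have "map (\<lambda>i. eval_term S a (?t i)) [0..<n + length c] = a @ c" if "a \<in> tuples n" for a
    using that by (intro nth_equalityI) (auto simp: tuples_def nth_append)
  moreover have "is_term S A n (?t i)" if "i < n + length c" for i
  proof (cases "i < n")
    case False
    then have "c ! (i - n) \<in> set c" using that by (intro nth_mem) linarith
    then show ?thesis using False assms(2) by auto
  qed simp
  ultimately show ?thesis using definable_subst[OF assms(1), of n ?t] by (simp cong: conj_cong)
qed

text \<open>Every \<open>A\<close>-definable set is a member of a \<open>\<emptyset>\<close>-definable family: the parameters become extra variables at
  the end of the environment, where the shifts caused by quantifiers do not disturb them.\<close>

lemma definable_abstract_params:
  assumes "definable S A n X"
  obtains c Y where "set c \<subseteq> A" "definable S {} (n + length c) Y" "X = {a \<in> tuples n. a @ c \<in> Y}"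
proof -
  obtain \<phi> where \<phi>: "is_form S A n \<phi>" "X = {a \<in> tuples n. sat S a \<phi>}"
    using assms unfolding definable_def by blast
  obtain B where B: "finite B" "B \<subseteq> A" "is_form S B n \<phi>"
    using is_form_finite_params[OF \<phi>(1)] by blast
  obtain c where c: "set c = B" using finite_list[OF B(1)] by blast
  have "\<exists>i < length c. c ! i = b" if "b \<in> B" for b
    using that c by (metis in_set_conv_nth)
  then obtain pos where pos: "\<And>b. b \<in> B \<Longrightarrow> pos b < length c \<and> c ! pos b = b" by metis
  let ?\<psi> = "subst_form Var (\<lambda>b. Var (n + pos b)) \<phi>"
  have "is_form S {} (n + length c) ?\<psi>"
    using B(3) by (rule is_form_subst) (auto simp: pos)
  then have "definable S {} (n + length c) {e \<in> tuples (n + length c). sat S e ?\<psi>}"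
    unfolding definable_def by blast
  moreover have "sat S (a @ c) ?\<psi> \<longleftrightarrow> sat S a \<phi>" if "a \<in> tuples n" for a
    using B(3) by (rule sat_subst) (use that pos in \<open>auto simp: nth_append tuples_def\<close>)
  then have "X = {a \<in> tuples n. a @ c \<in> {e \<in> tuples (n + length c). sat S e ?\<psi>}}"
    unfolding \<phi>(2) by (intro Collect_cong) (auto simp: tuples_def)
  moreover have "set c \<subseteq> A" using B(2) c by simp
  ultimately show thesis using that by blast
qed

text \<open>The formula is a quantified one because for \<open>n = 0\<close> there is no free variable to write an equation with.\<close>

lemma definable_full: "definable S A n (tuples n)"
  unfolding definable_def by (intro exI[of _ "Ex (Eql (Var 0) (Var 0))"]) auto

lemma definable_diagonal: "definable S A (n + n) {x @ x | x. x \<in> tuples n}"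
proof -
  have diag: "definable S A (n + n) {a \<in> tuples (n + n). \<forall>i < k. a ! i = a ! (n + i)}" if "k \<le> n" for k
    using that
  proof (induction k)
    case 0
    then show ?case using definable_full by simp
  next
    case (Suc k)
    have "definable S A (n + n) {a \<in> tuples (n + n). a ! k = a ! (n + k)}"
      unfolding definable_def using Suc.prems
      by (intro exI[of _ "Eql (Var k) (Var (n + k))"]) auto
    moreover have "definable S A (n + n) {a \<in> tuples (n + n). \<forall>i < k. a ! i = a ! (n + i)}"
      using Suc by simp
    ultimately have "definable S A (n + n) ({a \<in> tuples (n + n). a ! k = a ! (n + k)}
        \<inter> {a \<in> tuples (n + n). \<forall>i < k. a ! i = a ! (n + i)})"
      by (rule definable_Int)
    also have "{a \<in> tuples (n + n). a ! k = a ! (n + k)}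
        \<inter> {a \<in> tuples (n + n). \<forall>i < k. a ! i = a ! (n + i)}
        = {a \<in> tuples (n + n). \<forall>i < Suc k. a ! i = a ! (n + i)}"
      unfolding less_Suc_eq by blast
    finally show ?case .
  qed
  have eq: "{a \<in> tuples (n + n). \<forall>i < n. a ! i = a ! (n + i)} = {x @ x | x. x \<in> tuples n}"
  proof (intro equalityI subsetI)
    fix a assume a: "a \<in> {a \<in> tuples (n + n). \<forall>i < n. a ! i = a ! (n + i)}"
    then have "take n a = drop n a"
      by (intro nth_equalityI) (auto simp: tuples_def)
    then have "a = take n a @ take n a" by (metis append_take_drop_id)
    moreover have "take n a \<in> tuples n" using a by (auto simp: tuples_def)
    ultimately show "a \<in> {x @ x | x. x \<in> tuples n}" by blast
  qed (auto simp: tuples_def nth_append)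
  from diag[OF order_refl] show ?thesis unfolding eq .
qed

section \<open>Definable relations between tuples\<close>

text \<open>Definable sets live in powers of the universe, whereas the relations of interest hold between tuples.
  Here \<open>ns\<close> lists the lengths of the tuples related, and \<open>P\<close> receives the list of these tuples; a relation
  is identified with the set of concatenations. Tuples are addressed by their position in the list, so that
  quantification over a tuple shifts positions by one, just as it does for variables of formulas.\<close>

definition definable_rel ::
  "('f, 'r, 'm) fo_struct \<Rightarrow> 'm set \<Rightarrow> nat list \<Rightarrow> ('m list list \<Rightarrow> bool) \<Rightarrow> bool" where
  "definable_rel S A ns P \<longleftrightarrow>
     definable S A (sum_list ns) (concat ` {es. map length es = ns \<and> P es})"

text \<open>A string splits into blocks of prescribed lengths in only one way, so boolean operations on
  relations correspond to boolean operations on the sets of concatenations.\<close>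

lemma inj_on_concat_same_shape: "inj_on concat {es. map length es = ns}"
proof (rule inj_onI)
  fix es ds :: "'a list list"
  assume shape: "es \<in> {es. map length es = ns}" "ds \<in> {es. map length es = ns}"
    and eq: "concat es = concat ds"
  from shape have "map length es = map length ds" by simp
  then show "es = ds" using eq
  proof (induction es arbitrary: ds)
    case (Cons e es)
    then show ?case by (cases ds) auto
  qed auto
qed

lemma tuples_sum_list: "tuples (sum_list ns) = concat ` {es. map length es = ns}"
proof (intro equalityI subsetI)
  fix a :: "'a list" assume "a \<in> tuples (sum_list ns)"
  then show "a \<in> concat ` {es. map length es = ns}"
  proof (induction ns arbitrary: a)
    case (Cons k ns)
    then have "drop k a \<in> tuples (sum_list ns)" by (auto simp: tuples_def)
    then obtain es where "drop k a = concat es" "map length es = ns" using Cons.IH by blast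
    then have "a = concat (take k a # es)" by (metis append_take_drop_id concat.simps(2))
    moreover have "length (take k a) = k" using Cons.prems by (auto simp: tuples_def)
    then have "take k a # es \<in> {es. map length es = k # ns}"
      using \<open>map length es = ns\<close> by (simp only: list.map mem_Collect_eq)
    ultimately show ?case by (rule image_eqI)
  qed (auto simp: tuples_def)
qed (auto simp: tuples_def length_concat)

lemma definable_rel_Not:
  assumes "definable_rel S A ns P"
  shows "definable_rel S A ns (\<lambda>es. \<not> P es)"
proof -
  have "tuples (sum_list ns) - concat ` {es. map length es = ns \<and> P es}
      = concat ` ({es. map length es = ns} - {es. map length es = ns \<and> P es})"
    unfolding tuples_sum_list
    by (rule inj_on_image_set_diff[OF inj_on_concat_same_shape[of ns], symmetric]) auto
  also have "{es. map length es = ns} - {es. map length es = ns \<and> P es} = {es. map length es = ns \<and> \<not> P es}"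
    by blast
  finally show ?thesis
    using definable_Compl[OF assms[unfolded definable_rel_def]] unfolding definable_rel_def by (simp only:)
qed

lemma definable_rel_conj:
  assumes "definable_rel S A ns P" "definable_rel S A ns R"
  shows "definable_rel S A ns (\<lambda>es. P es \<and> R es)"
proof -
  have "concat ` {es. map length es = ns \<and> P es} \<inter> concat ` {es. map length es = ns \<and> R es}
      = concat ` ({es. map length es = ns \<and> P es} \<inter> {es. map length es = ns \<and> R es})"
    by (rule inj_on_image_Int[OF inj_on_concat_same_shape[of ns], symmetric]) auto
  also have "{es. map length es = ns \<and> P es} \<inter> {es. map length es = ns \<and> R es}
      = {es. map length es = ns \<and> P es \<and> R es}"
    by blast
  finally show ?thesis
    using definable_Int[OF assms[unfolded definable_rel_def]] unfolding definable_rel_def by (simp only:)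
qed

lemma definable_rel_iff:
  assumes "definable_rel S A ns P" "definable_rel S A ns R"
  shows "definable_rel S A ns (\<lambda>es. P es \<longleftrightarrow> R es)"
proof -
  have "(\<lambda>es. P es \<longleftrightarrow> R es) = (\<lambda>es. \<not> (P es \<and> \<not> R es) \<and> \<not> (R es \<and> \<not> P es))" by auto
  moreover have "definable_rel S A ns (\<lambda>es. \<not> (P es \<and> \<not> R es) \<and> \<not> (R es \<and> \<not> P es))"
    by (intro definable_rel_conj definable_rel_Not assms)
  ultimately show ?thesis by simp
qed

lemma filter_image: "{a \<in> f ` {e. E e}. Q a} = f ` {e. E e \<and> Q (f e)}"
  by auto

lemma definable_rel_ex:
  assumes "definable_rel S A (k # ns) P"
  shows "definable_rel S A ns (\<lambda>es. \<exists>u \<in> tuples k. P (u # es))"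
proof -
  let ?X = "concat ` {es. map length es = k # ns \<and> P es}"
  have iff: "u @ concat es \<in> ?X \<longleftrightarrow> P (u # es)" if "length u = k" "map length es = ns" for u es
  proof -
    have "concat (u # es) \<in> ?X \<longleftrightarrow> u # es \<in> {es. map length es = k # ns \<and> P es}"
      by (rule inj_on_image_mem_iff[OF inj_on_concat_same_shape[of "k # ns"]]) (use that in auto)
    then show ?thesis using that by simp
  qed
  have cong: "(\<exists>u \<in> tuples k. u @ concat es \<in> ?X) \<longleftrightarrow> (\<exists>u \<in> tuples k. P (u # es))"
    if "map length es = ns" for es
    by (intro bex_cong refl iff that) (simp only: tuples_def mem_Collect_eq)
  have "{a \<in> tuples (sum_list ns). \<exists>u \<in> tuples k. u @ a \<in> ?X}
      = concat ` {es. map length es = ns \<and> (\<exists>u \<in> tuples k. u @ concat es \<in> ?X)}"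
    unfolding tuples_sum_list by (rule filter_image)
  also have "{es. map length es = ns \<and> (\<exists>u \<in> tuples k. u @ concat es \<in> ?X)}
      = {es. map length es = ns \<and> (\<exists>u \<in> tuples k. P (u # es))}"
    by (intro Collect_cong conj_cong refl cong)
  finally show ?thesis
    using definable_projection[of S A k "sum_list ns" ?X] assms
    unfolding definable_rel_def sum_list.Cons by (simp only:)
qed

lemma definable_rel_all:
  assumes "definable_rel S A (k # ns) P"
  shows "definable_rel S A ns (\<lambda>es. \<forall>u \<in> tuples k. P (u # es))"
  using definable_rel_Not[OF definable_rel_ex[OF definable_rel_Not[OF assms]]] by simp

lemma concat_nth_block:
  assumes "j < length es"
  defines "d \<equiv> sum_list (map length (take j es))"
  shows "map ((!) (concat es)) [d..<d + length (es ! j)] = es ! j"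
proof (rule nth_equalityI)
  fix i assume i: "i < length (map ((!) (concat es)) [d..<d + length (es ! j)])"
  have "concat es = concat (take j es) @ es ! j @ concat (drop (Suc j) es)"
    using assms(1) by (metis append_take_drop_id concat.simps(2) concat_append id_take_nth_drop)
  then show "map ((!) (concat es)) [d..<d + length (es ! j)] ! i = es ! j ! i"
    using i by (simp add: d_def nth_append length_concat)
qed auto

text \<open>The atomic relations: some of the tuples, in any order and possibly repeated, form together an element
  of a definable set. Every definability argument below combines these by connectives and
  quantifiers over tuples.\<close>

lemma definable_rel_mem:
  assumes "definable S A k X" "\<forall>j \<in> set js. j < length ns" "k = sum_list (map ((!) ns) js)"
  shows "definable_rel S A ns (\<lambda>es. concat (map ((!) es) js) \<in> X)"
proof -
  let ?off = "\<lambda>j. sum_list (take j ns)"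
  let ?is = "concat (map (\<lambda>j. [?off j..<?off j + ns ! j]) js)"
  have eq: "map ((!) (concat es)) ?is = concat (map ((!) es) js)" if "map length es = ns" for es :: "'c list list"
  proof -
    have "map ((!) (concat es)) [?off j..<?off j + ns ! j] = es ! j" if "j \<in> set js" for j
    proof -
      have "j < length es" using assms(2) that \<open>map length es = ns\<close> by auto
      from concat_nth_block[OF this] show ?thesis using \<open>map length es = ns\<close> \<open>j < length es\<close>
        by (auto simp: take_map)
    qed
    then show ?thesis by (simp add: map_concat o_def cong: map_cong)
  qed
  have lt: "i < sum_list ns" if "i \<in> set ?is" for i
  proof -
    from that have "\<exists>j \<in> set js. i < ?off j + ns ! j" by auto
    then obtain j where j: "j \<in> set js" "i < ?off j + ns ! j" by blast
    have "sum_list ns = ?off j + ns ! j + sum_list (drop (Suc j) ns)"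
      using assms(2) j(1) by (metis id_take_nth_drop sum_list.append sum_list.Cons add.assoc)
    then show ?thesis using j by linarith
  qed
  have "definable S A (sum_list ns) {a \<in> tuples (sum_list ns). map ((!) a) ?is \<in> X}"
    using lt assms(1,3) by (intro definable_reindex) (auto simp: length_concat o_def)
  moreover have "{a \<in> tuples (sum_list ns). map ((!) a) ?is \<in> X}
      = concat ` {es. map length es = ns \<and> map ((!) (concat es)) ?is \<in> X}"
    unfolding tuples_sum_list by (rule filter_image)
  moreover have "{es. map length es = ns \<and> map ((!) (concat es)) ?is \<in> X}
      = {es. map length es = ns \<and> concat (map ((!) es) js) \<in> X}"
    by (intro Collect_cong conj_cong refl) (simp only: eq)
  ultimately show ?thesis unfolding definable_rel_def by simp
qed

lemma definable_rel_unary: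
  "definable_rel S A [m] P \<longleftrightarrow> definable S A m {x. x \<in> tuples m \<and> P [x]}"
proof -
  have "{es. map length es = [m] \<and> P es} = (\<lambda>x. [x]) ` {x. x \<in> tuples m \<and> P [x]}"
    by (auto simp: map_eq_Cons_conv tuples_def)
  then have "concat ` {es. map length es = [m] \<and> P es} = {x. x \<in> tuples m \<and> P [x]}"
    by (simp add: image_image)
  then show ?thesis by (simp add: definable_rel_def)
qed

lemma definable_rel_binary:
  "definable_rel S A [m, n] P \<longleftrightarrow>
     definable S A (m + n) {x @ y | x y. x \<in> tuples m \<and> y \<in> tuples n \<and> P [x, y]}"
proof -
  have "{es. map length es = [m, n] \<and> P es} = {[x, y] | x y. x \<in> tuples m \<and> y \<in> tuples n \<and> P [x, y]}"
    by (auto simp: map_eq_Cons_conv tuples_def)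
  then have "concat ` {es. map length es = [m, n] \<and> P es}
      = concat ` {[x, y] | x y. x \<in> tuples m \<and> y \<in> tuples n \<and> P [x, y]}" by simp
  also have "\<dots> = {x @ y | x y. x \<in> tuples m \<and> y \<in> tuples n \<and> P [x, y]}"
    by force
  finally show ?thesis by (simp add: definable_rel_def)
qed

lemma definable_rel_ternary:
  "definable_rel S A [m, n, k] P \<longleftrightarrow> definable S A (m + n + k)
     {x @ y @ z | x y z. x \<in> tuples m \<and> y \<in> tuples n \<and> z \<in> tuples k \<and> P [x, y, z]}"
proof -
  have "{es. map length es = [m, n, k] \<and> P es}
      = {[x, y, z] | x y z. x \<in> tuples m \<and> y \<in> tuples n \<and> z \<in> tuples k \<and> P [x, y, z]}"
    by (auto simp: map_eq_Cons_conv tuples_def)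
  then have "concat ` {es. map length es = [m, n, k] \<and> P es}
      = concat ` {[x, y, z] | x y z. x \<in> tuples m \<and> y \<in> tuples n \<and> z \<in> tuples k \<and> P [x, y, z]}" by simp
  also have "\<dots> = {x @ y @ z | x y z. x \<in> tuples m \<and> y \<in> tuples n \<and> z \<in> tuples k \<and> P [x, y, z]}"
    by force
  finally show ?thesis by (simp add: definable_rel_def add.assoc)
qed

section \<open>Invariance under automorphisms\<close>

lemma eval_term_Aut:
  assumes "\<sigma> \<in> Aut S A" "is_term S A n t" "n \<le> length e"
  shows "eval_term S (map \<sigma> e) t = \<sigma> (eval_term S e t)"
  using assms(2)
proof (induction t)
  case (Var i)
  then show ?case using assms(3) by simp
next
  case (Par c)
  then show ?case using assms(1) by (simp add: Aut_def)
next
  case (App f ts)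
  then have "map (eval_term S (map \<sigma> e)) ts = map \<sigma> (map (eval_term S e) ts)" by simp
  moreover have "\<sigma> (fun_int S f (map (eval_term S e) ts)) = fun_int S f (map \<sigma> (map (eval_term S e) ts))"
  proof -
    have "map (eval_term S e) ts \<in> tuples (length ts)" by (simp add: tuples_def)
    moreover have "(f, length ts) \<in> fun_syms S" using App.prems by simp
    ultimately show ?thesis using assms(1) unfolding Aut_def by blast
  qed
  ultimately show ?case by (simp only: eval_term.simps)
qed

lemma sat_Aut:
  assumes "\<sigma> \<in> Aut S A" "is_form S A n \<phi>" "n \<le> length e"
  shows "sat S (map \<sigma> e) \<phi> \<longleftrightarrow> sat S e \<phi>"
  using assms(2,3)
proof (induction \<phi> arbitrary: n e)
  case (Eql s t)
  have "inj \<sigma>" using assms(1) by (simp add: Aut_def bij_is_inj)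
  then show ?case
    using Eql eval_term_Aut[OF assms(1), of n s e] eval_term_Aut[OF assms(1), of n t e]
    by (simp add: inj_eq)
next
  case (Rel r ts)
  have "eval_term S (map \<sigma> e) t = \<sigma> (eval_term S e t)" if "t \<in> set ts" for t
    by (rule eval_term_Aut[OF assms(1), of n]) (use Rel.prems that in simp_all)
  then have "map (eval_term S (map \<sigma> e)) ts = map \<sigma> (map (eval_term S e) ts)" by simp
  moreover have "rel_int S r (map (eval_term S e) ts) \<longleftrightarrow> rel_int S r (map \<sigma> (map (eval_term S e) ts))"
  proof -
    have "map (eval_term S e) ts \<in> tuples (length ts)" by (simp add: tuples_def)
    moreover have "(r, length ts) \<in> rel_syms S" using Rel.prems by simp
    ultimately show ?thesis using assms(1) unfolding Aut_def by blast
  qed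
  ultimately show ?case by (simp only: sat.simps)
next
  case (Neg \<phi>)
  then show ?case using Neg.IH[of n e] by simp
next
  case (Conj \<phi> \<psi>)
  then show ?case using Conj.IH(1)[of n e] Conj.IH(2)[of n e] by simp
next
  case (Ex \<phi>)
  have "surj \<sigma>" using assms(1) by (simp add: Aut_def bij_is_surj)
  then have "(\<exists>m. sat S (m # map \<sigma> e) \<phi>) \<longleftrightarrow> (\<exists>m. sat S (\<sigma> m # map \<sigma> e) \<phi>)"
    by (metis surjD)
  also have "\<dots> \<longleftrightarrow> (\<exists>m. sat S (m # e) \<phi>)"
    using Ex.IH[of "Suc n"] Ex.prems by (metis (no_types) Suc_le_mono is_form.simps(5) length_Cons list.map(2))
  finally show ?case by simp
qed

text \<open>All equivariance statements of the proof come from this one, applied to the carriers of groups and to the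
  graphs of multiplications and of the projection.\<close>

lemma definable_Aut:
  assumes "\<sigma> \<in> Aut S A" "definable S A n X" "length x = n"
  shows "map \<sigma> x \<in> X \<longleftrightarrow> x \<in> X"
  using assms sat_Aut[OF assms(1), of n _ x] unfolding definable_def tuples_def by auto

lemma id_Aut: "id \<in> Aut S A"
  by (auto simp: Aut_def)

lemma comp_Aut:
  assumes "\<sigma> \<in> Aut S A" "\<tau> \<in> Aut S A"
  shows "\<sigma> \<circ> \<tau> \<in> Aut S A"
proof -
  have "(\<sigma> \<circ> \<tau>) (fun_int S f a) = fun_int S f (map (\<sigma> \<circ> \<tau>) a)"
    if "(f, l) \<in> fun_syms S" "a \<in> tuples l" for f l a
  proof -
    have "map \<tau> a \<in> tuples l" using that(2) by (simp add: tuples_def)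
    then have "\<sigma> (fun_int S f (map \<tau> a)) = fun_int S f (map \<sigma> (map \<tau> a))"
      "\<tau> (fun_int S f a) = fun_int S f (map \<tau> a)"
      using assms that unfolding Aut_def by blast+
    then show ?thesis by simp
  qed
  moreover have "rel_int S r a \<longleftrightarrow> rel_int S r (map (\<sigma> \<circ> \<tau>) a)"
    if "(r, l) \<in> rel_syms S" "a \<in> tuples l" for r l a
  proof -
    have "map \<tau> a \<in> tuples l" using that(2) by (simp add: tuples_def)
    then have "rel_int S r (map \<tau> a) = rel_int S r (map \<sigma> (map \<tau> a))"
      "rel_int S r a = rel_int S r (map \<tau> a)"
      using assms that unfolding Aut_def by blast+
    then show ?thesis by simp
  qed
  moreover have "bij (\<sigma> \<circ> \<tau>)" using assms by (simp add: Aut_def bij_comp)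
  ultimately show ?thesis using assms by (auto simp: Aut_def)
qed

section \<open>Classifying the fibres of a definable family\<close>

text \<open>Elimination of imaginaries for the fibres of a definable family \<open>W\<close>: having the same fibre is an
  equivalence relation whatever \<open>W\<close> is, so once the parameters of \<open>W\<close> are replaced by variables it is a
  \<open>\<emptyset>\<close>-definable equivalence relation, and its classifying function can be specialised at the parameters
  again.\<close>

lemma definable_family_classifier:
  assumes "eliminates_imaginaries S" "definable S A (p + n) W"
  shows "\<exists>k g. definable S A (n + k) {x @ g x | x. x \<in> tuples n}
    \<and> (\<forall>x \<in> tuples n. g x \<in> tuples k)
    \<and> (\<forall>x \<in> tuples n. \<forall>y \<in> tuples n. g x = g y \<longleftrightarrow> (\<forall>u \<in> tuples p. u @ x \<in> W \<longleftrightarrow> u @ y \<in> W))"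
proof -
  obtain c Y where c: "set c \<subseteq> A" and Y: "definable S {} (p + n + length c) Y"
    and W: "W = {a \<in> tuples (p + n). a @ c \<in> Y}"
    using definable_abstract_params[OF assms(2)] by metis
  let ?m = "length c"
  let ?R = "\<lambda>v w. \<forall>u \<in> tuples p. u @ v \<in> Y \<longleftrightarrow> u @ w \<in> Y"
  \<comment> \<open>An element of \<open>?E\<close> compares fibres at two different values of the parameters as well; the pairs
    with equal parameters \<open>c\<close> are the ones read off at the end.\<close>
  let ?E = "{(v, w). v \<in> tuples (n + ?m) \<and> w \<in> tuples (n + ?m) \<and> ?R v w}"
  have "definable_rel S {} [p, n + ?m, n + ?m] (\<lambda>es. es ! 0 @ es ! 1 \<in> Y)"
    using definable_rel_mem[OF Y, of "[0, 1]" "[p, n + ?m, n + ?m]"] by (simp add: add.assoc less_Suc_eq)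
  moreover have "definable_rel S {} [p, n + ?m, n + ?m] (\<lambda>es. es ! 0 @ es ! 2 \<in> Y)"
    using definable_rel_mem[OF Y, of "[0, 2]" "[p, n + ?m, n + ?m]"] by (simp add: add.assoc less_Suc_eq)
  ultimately have "definable_rel S {} [n + ?m, n + ?m]
      (\<lambda>es. \<forall>u \<in> tuples p. (u # es) ! 0 @ (u # es) ! 1 \<in> Y \<longleftrightarrow> (u # es) ! 0 @ (u # es) ! 2 \<in> Y)"
    by (intro definable_rel_all definable_rel_iff)
  then have E_def: "definable S {} ((n + ?m) + (n + ?m)) {x @ y | x y. (x, y) \<in> ?E}"
    by (simp add: definable_rel_binary conj_assoc)
  have E_equiv: "equiv (tuples (n + ?m)) ?E"
    by (rule equivI) (auto simp: refl_on_def sym_def trans_def)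
  have "\<exists>k f. definable_pfun S {} (n + ?m) k f \<and> dom f = tuples (n + ?m)
      \<and> (\<forall>v \<in> tuples (n + ?m). \<forall>w \<in> tuples (n + ?m). (v, w) \<in> ?E \<longleftrightarrow> f v = f w)"
    by (rule assms(1)[unfolded eliminates_imaginaries_def, rule_format, OF conjI[OF E_equiv E_def]])
  then obtain k f where f: "definable_pfun S {} (n + ?m) k f" "dom f = tuples (n + ?m)"
    and fE: "\<forall>v \<in> tuples (n + ?m). \<forall>w \<in> tuples (n + ?m). (v, w) \<in> ?E \<longleftrightarrow> f v = f w"
    by (elim exE conjE)
  define g where "g x = the (f (x @ c))" for x
  have app_c: "x @ c \<in> tuples (n + ?m)" if "x \<in> tuples n" for x using that by (simp add: tuples_def)
  have fg: "f (x @ c) = Some (g x)" if "x \<in> tuples n" for x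
  proof -
    have "x @ c \<in> dom f" using app_c[OF that] f(2) by simp
    then show ?thesis unfolding g_def by (auto simp: dom_def)
  qed
  have gk: "g x \<in> tuples k" if "x \<in> tuples n" for x
    using fg[OF that] f(1) unfolding definable_pfun_def by (meson ranI subsetD)
  define \<Gamma> where "\<Gamma> = {v @ w | v w. f v = Some w}"
  have \<Gamma>_iff: "v @ w \<in> \<Gamma> \<longleftrightarrow> f v = Some w" if "v \<in> tuples (n + ?m)" for v w
  proof -
    have "length v' = length v" if "f v' = Some w'" for v' w'
      using f(2) that \<open>v \<in> tuples (n + ?m)\<close> by (auto simp: tuples_def)
    then show ?thesis unfolding \<Gamma>_def by (auto simp: append_eq_append_conv)
  qed
  have "definable S {} (n + ?m + k) \<Gamma>"
    using f(1) unfolding definable_pfun_def \<Gamma>_def by simp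
  then have "definable S A (n + ?m + k) \<Gamma>" by (rule definable_mono) simp
  then have "definable_rel S A [n, k, ?m] (\<lambda>es. es ! 0 @ es ! 2 @ es ! 1 \<in> \<Gamma>)"
    using definable_rel_mem[of S A "n + ?m + k" \<Gamma> "[0, 2, 1]" "[n, k, ?m]"] by (simp add: add.assoc)
  then have "definable S A (n + k + ?m)
      {x @ y @ z | x y z. x \<in> tuples n \<and> y \<in> tuples k \<and> z \<in> tuples ?m \<and> x @ z @ y \<in> \<Gamma>}"
    (is "definable _ _ _ ?T") by (simp add: definable_rel_ternary)
  then have "definable S A (n + k) {a \<in> tuples (n + k). a @ c \<in> ?T}"
    using c by (rule definable_fix_params)
  also have "{a \<in> tuples (n + k). a @ c \<in> ?T} = {x @ g x | x. x \<in> tuples n}" (is "?L = ?R")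
  proof (intro equalityI subsetI)
    fix a assume "a \<in> ?L"
    then have a: "a @ c \<in> ?T" by blast
    obtain x y z where xyz: "a @ c = (x @ y) @ z" "x \<in> tuples n" "y \<in> tuples k" "z \<in> tuples ?m"
      "x @ z @ y \<in> \<Gamma>" using a by auto
    have "length c = length z" using xyz(4) by (simp add: tuples_def)
    then have "a = x @ y" "z = c" using xyz(1) append_eq_append_conv by blast+
    moreover have "(x @ c) @ y \<in> \<Gamma>" using xyz(5) \<open>z = c\<close> by simp
    then have "y = g x" using \<Gamma>_iff[OF app_c[OF xyz(2)]] fg[OF xyz(2)] by simp
    ultimately show "a \<in> ?R" using xyz(2) by blast
  next
    fix a assume "a \<in> ?R"
    then obtain x where x: "a = x @ g x" "x \<in> tuples n" by blast
    have "(x @ c) @ g x \<in> \<Gamma>" using fg[OF x(2)] \<Gamma>_iff[OF app_c[OF x(2)]] by simp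
    then have "a @ c = x @ g x @ c \<and> x \<in> tuples n \<and> g x \<in> tuples k \<and> c \<in> tuples ?m \<and> x @ c @ g x \<in> \<Gamma>"
      using x gk[OF x(2)] by (simp add: tuples_def)
    then have "a @ c \<in> ?T" by blast
    moreover have "a \<in> tuples (n + k)" using x gk[OF x(2)] by (simp add: tuples_def)
    ultimately show "a \<in> ?L" by blast
  qed
  finally have "definable S A (n + k) {x @ g x | x. x \<in> tuples n}" .
  moreover have "g x = g y \<longleftrightarrow> (\<forall>u \<in> tuples p. u @ x \<in> W \<longleftrightarrow> u @ y \<in> W)"
    if "x \<in> tuples n" "y \<in> tuples n" for x y
  proof -
    have "g x = g y \<longleftrightarrow> (x @ c, y @ c) \<in> ?E"
      using bspec[OF bspec[OF fE app_c[OF that(1)]] app_c[OF that(2)]] fg that by simp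
    also have "\<dots> \<longleftrightarrow> (\<forall>u \<in> tuples p. u @ x \<in> W \<longleftrightarrow> u @ y \<in> W)"
      using app_c[OF that(1)] app_c[OF that(2)] that unfolding W by (simp add: tuples_def)
    finally show ?thesis .
  qed
  ultimately show ?thesis using gk by blast
qed

section \<open>Definable groups and their quotients\<close>

definition mult_graph :: "'m list monoid \<Rightarrow> 'm list set" where
  "mult_graph G = {x @ y @ (x \<otimes>\<^bsub>G\<^esub> y) | x y. x \<in> carrier G \<and> y \<in> carrier G}"

lemma definable_group_tuples:
  "definable_group S A n G \<Longrightarrow> x \<in> carrier G \<Longrightarrow> x \<in> tuples n"
  using definable_tuples unfolding definable_group_def by blast

lemma definable_mult_graph: "definable_group S A n G \<Longrightarrow> definable S A (n + n + n) (mult_graph G)"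
  unfolding definable_group_def mult_graph_def by blast

text \<open>Membership in the graph recovers the arguments because all elements of the group have the
  same length.\<close>

lemma mult_graph_iff:
  assumes "definable_group S A n G" "x \<in> tuples n" "y \<in> tuples n"
  shows "x @ y @ z \<in> mult_graph G \<longleftrightarrow> x \<in> carrier G \<and> y \<in> carrier G \<and> z = x \<otimes>\<^bsub>G\<^esub> y"
proof
  assume "x @ y @ z \<in> mult_graph G"
  then obtain x' y' where eq: "x @ y @ z = x' @ y' @ (x' \<otimes>\<^bsub>G\<^esub> y')" and c: "x' \<in> carrier G" "y' \<in> carrier G"
    unfolding mult_graph_def by blast
  have "x' \<in> tuples n" "y' \<in> tuples n" using c definable_group_tuples[OF assms(1)] by blast+
  then have "length x = length x'" "length y = length y'" using assms(2,3) by (simp_all add: tuples_def)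
  then show "x \<in> carrier G \<and> y \<in> carrier G \<and> z = x \<otimes>\<^bsub>G\<^esub> y" using eq c by simp
qed (auto simp: mult_graph_def)

text \<open>The fibre over \<open>x\<close> of the family \<open>W\<close> is the coset \<open>N x\<close>, so its classifier \<open>g\<close> takes equal values
  exactly on elements of the same coset. The image of \<open>G\<close> under \<open>g\<close>, with the multiplication transported
  along \<open>g\<close>, is the quotient; its graph is a projection of definable sets.\<close>

lemma definable_quotient_exists:
  fixes G (structure)
  assumes EI: "eliminates_imaginaries S" and G: "definable_group S A n G"
    and N: "definable S A n N" and normal: "N \<lhd> G"
  obtains k Q \<iota> where "definable_quotient S A n G N k Q \<iota>"
proof -
  interpret normal N G by (rule normal)
  let ?Mult = "mult_graph G"
  define W where "W = {u @ x | u x. x \<in> carrier G \<and> u \<in> N #> x}"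
  have carr: "definable S A n (carrier G)"
    using G unfolding definable_group_def by blast
  note mult = definable_mult_graph[OF G]
  note Gt = definable_group_tuples[OF G]
  have Gn: "\<And>x. x \<in> carrier G \<Longrightarrow> length x = n" using Gt by (simp add: tuples_def)
  note mult_iff = mult_graph_iff[OF G]
  have "definable_rel S A [n, n, n] (\<lambda>es. es ! 0 \<in> N)"
    using definable_rel_mem[OF N, of "[0]" "[n, n, n]"] by simp
  moreover have "definable_rel S A [n, n, n] (\<lambda>es. es ! 0 @ es ! 2 @ es ! 1 \<in> ?Mult)"
    using definable_rel_mem[OF mult, of "[0, 2, 1]" "[n, n, n]"] by simp
  ultimately have "definable_rel S A [n, n]
      (\<lambda>es. \<exists>w \<in> tuples n. (w # es) ! 0 \<in> N \<and> (w # es) ! 0 @ (w # es) ! 2 @ (w # es) ! 1 \<in> ?Mult)"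
    by (intro definable_rel_ex definable_rel_conj)
  then have "definable S A (n + n) {u @ x | u x. u \<in> tuples n \<and> x \<in> tuples n \<and>
      (\<exists>w \<in> tuples n. w \<in> N \<and> w @ x @ u \<in> ?Mult)}"
    by (simp add: definable_rel_binary)
  also have "{u @ x | u x. u \<in> tuples n \<and> x \<in> tuples n \<and> (\<exists>w \<in> tuples n. w \<in> N \<and> w @ x @ u \<in> ?Mult)} = W"
  proof -
    have "u \<in> tuples n \<and> x \<in> tuples n \<and> (\<exists>w \<in> tuples n. w \<in> N \<and> w @ x @ u \<in> ?Mult)
        \<longleftrightarrow> x \<in> carrier G \<and> u \<in> N #> x" for u x
    proof
      assume l: "u \<in> tuples n \<and> x \<in> tuples n \<and> (\<exists>w \<in> tuples n. w \<in> N \<and> w @ x @ u \<in> ?Mult)"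
      then obtain w where w: "w \<in> tuples n" "w \<in> N" "w @ x @ u \<in> ?Mult" by blast
      then have "x \<in> carrier G" "u = w \<otimes> x"
        using mult_iff[of w x u] l by simp_all
      then show "x \<in> carrier G \<and> u \<in> N #> x" using w(2) by (auto simp: r_coset_def)
    next
      assume r: "x \<in> carrier G \<and> u \<in> N #> x"
      then obtain w where w: "w \<in> N" "u = w \<otimes> x" by (auto simp: r_coset_def)
      then have "w \<in> carrier G" using subset by blast
      then have "u \<in> carrier G" "w @ x @ u \<in> ?Mult" using r w(2) mult_iff[of w x u] Gt by simp_all
      then show "u \<in> tuples n \<and> x \<in> tuples n \<and> (\<exists>w \<in> tuples n. w \<in> N \<and> w @ x @ u \<in> ?Mult)"
        using Gt r w(1) \<open>w \<in> carrier G\<close> by blast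
    qed
    then show ?thesis unfolding W_def by (simp only:)
  qed
  finally have W: "definable S A (n + n) W" .
  obtain k g where g: "definable S A (n + k) {x @ g x | x. x \<in> tuples n}"
    and gk: "\<forall>x \<in> tuples n. g x \<in> tuples k"
    and g_eq: "\<forall>x \<in> tuples n. \<forall>y \<in> tuples n. g x = g y \<longleftrightarrow> (\<forall>u \<in> tuples n. u @ x \<in> W \<longleftrightarrow> u @ y \<in> W)"
    using definable_family_classifier[OF EI W] by (elim exE conjE)
  have g_coset: "g x = g y \<longleftrightarrow> N #> x = N #> y" if xy: "x \<in> carrier G" "y \<in> carrier G" for x y
  proof -
    have "u @ z \<in> W \<longleftrightarrow> u \<in> N #> z" if "z \<in> carrier G" "u \<in> tuples n" for u z
    proof
      assume "u @ z \<in> W"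
      then obtain u' z' where eq: "u @ z = u' @ z'" and c: "z' \<in> carrier G" "u' \<in> N #> z'"
        unfolding W_def by blast
      have "length z = length z'" using c(1) that(1) Gn by simp
      then show "u \<in> N #> z" using eq c by simp
    qed (use that(1) in \<open>auto simp: W_def\<close>)
    then have "g x = g y \<longleftrightarrow> (\<forall>u \<in> tuples n. u \<in> N #> x \<longleftrightarrow> u \<in> N #> y)"
      using bspec[OF bspec[OF g_eq Gt[OF xy(1)]] Gt[OF xy(2)]] xy by simp
    moreover have "N #> z \<subseteq> tuples n" if "z \<in> carrier G" for z
      using that Gt r_coset_subset_G[OF subset] by blast
    ultimately show ?thesis using xy by blast
  qed
  \<comment> \<open>The operation of \<open>Q\<close> must be a function on all tuples, so a section of \<open>g\<close> is chosen; on the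
    carrier the result does not depend on the choice because \<open>N\<close> is normal.\<close>
  define q where "q a = (SOME x. x \<in> carrier G \<and> g x = a)" for a
  have q: "q (g x) \<in> carrier G" "g (q (g x)) = g x" if "x \<in> carrier G" for x
    using someI[of "\<lambda>y. y \<in> carrier G \<and> g y = g x" x] that unfolding q_def by auto
  define Q where "Q = \<lparr>carrier = g ` carrier G, mult = (\<lambda>a b. g (q a \<otimes> q b)), one = g \<one>\<rparr>"
  have g_mult: "g x \<otimes>\<^bsub>Q\<^esub> g y = g (x \<otimes> y)" if xy: "x \<in> carrier G" "y \<in> carrier G" for x y
  proof -
    have "N #> q (g x) = N #> x" "N #> q (g y) = N #> y"
      using q g_coset xy by blast+
    then have "N #> (q (g x) \<otimes> q (g y)) = N #> (x \<otimes> y)"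
      using rcos_sum xy q by metis
    then show ?thesis using g_coset xy q by (simp add: Q_def)
  qed
  have g_hom: "g \<in> hom G Q" unfolding hom_def using g_mult by (auto simp: Q_def)
  have "group Q" using hom_imp_img_group[OF g_hom] by (simp add: Q_def)
  have gh: "group_hom G Q g"
    by (intro group_hom.intro group_hom_axioms.intro is_group \<open>group Q\<close> g_hom)
  have ker: "kernel G Q g = N"
  proof -
    have "g x = \<one>\<^bsub>Q\<^esub> \<longleftrightarrow> x \<in> N" if "x \<in> carrier G" for x
    proof -
      have "g x = \<one>\<^bsub>Q\<^esub> \<longleftrightarrow> N #> x = N"
        using g_coset[OF that one_closed] coset_mult_one[OF subset] by (simp add: Q_def)
      also have "\<dots> \<longleftrightarrow> x \<in> N"
        using coset_join1[OF _ that subgroup_axioms] coset_join2[OF that subgroup_axioms] by blast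
      finally show ?thesis .
    qed
    then show ?thesis using subset unfolding kernel_def by blast
  qed
  have iso: "(\<lambda>X. the_elem (g ` X)) \<in> iso (G Mod N) Q"
    using group_hom.FactGroup_iso_set[OF gh] unfolding ker by (simp add: Q_def)
  have proj: "quot_proj G N (\<lambda>X. the_elem (g ` X)) x = g x" if "x \<in> carrier G" for x
  proof -
    have "g y = g x" if "y \<in> N #> x" for y
      using that \<open>x \<in> carrier G\<close> g_coset repr_independence[OF that _ subgroup_axioms]
        r_coset_subset_G[OF subset] by blast
    moreover have "x \<in> N #> x" using rcos_self that subgroup_axioms by blast
    ultimately have "g ` (N #> x) = {g x}" by blast
    then show ?thesis by (simp add: quot_proj_def)
  qed
  define \<Gamma> where "\<Gamma> = {x @ g x | x. x \<in> carrier G}"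
  have \<Gamma>: "definable S A (n + k) \<Gamma>"
  proof -
    have "definable_rel S A [n, k] (\<lambda>es. es ! 0 \<in> carrier G)"
      using definable_rel_mem[OF carr, of "[0]" "[n, k]"] by simp
    then have "definable S A (n + k) {x @ y | x y. x \<in> tuples n \<and> y \<in> tuples k \<and> x \<in> carrier G}"
      by (simp add: definable_rel_binary)
    from definable_Int[OF g this]
    have "definable S A (n + k) ({x @ g x | x. x \<in> tuples n} \<inter>
      {x @ y | x y. x \<in> tuples n \<and> y \<in> tuples k \<and> x \<in> carrier G})" .
    also have "{x @ g x | x. x \<in> tuples n} \<inter> {x @ y | x y. x \<in> tuples n \<and> y \<in> tuples k \<and> x \<in> carrier G} = \<Gamma>"
      (is "?A \<inter> ?B = _")
    proof (intro equalityI subsetI)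
      fix a assume "a \<in> ?A \<inter> ?B"
      then obtain x x' y where a: "a = x @ g x" "x \<in> tuples n" "a = x' @ y" "x' \<in> tuples n" "x' \<in> carrier G"
        by blast
      then have "x = x'" by (simp add: tuples_def)
      then show "a \<in> \<Gamma>" using a unfolding \<Gamma>_def by blast
    next
      fix a assume "a \<in> \<Gamma>"
      then obtain x where "a = x @ g x" "x \<in> carrier G" unfolding \<Gamma>_def by blast
      then show "a \<in> ?A \<inter> ?B" using Gt gk by blast
    qed
    finally show ?thesis .
  qed
  have \<Gamma>_iff: "x @ a \<in> \<Gamma> \<longleftrightarrow> x \<in> carrier G \<and> a = g x" if "length x = n" for x a
  proof
    assume "x @ a \<in> \<Gamma>"
    then obtain y where y: "x @ a = y @ g y" "y \<in> carrier G" unfolding \<Gamma>_def by blast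
    then have "length x = length y" using Gn that by simp
    then show "x \<in> carrier G \<and> a = g x" using y by simp
  qed (auto simp: \<Gamma>_def)
  have "definable S A k (carrier Q)"
  proof -
    have "definable_rel S A [k] (\<lambda>es. \<exists>x \<in> tuples n. (x # es) ! 0 @ (x # es) ! 1 \<in> \<Gamma>)"
      by (rule definable_rel_ex) (use definable_rel_mem[OF \<Gamma>, of "[0, 1]" "[n, k]"] in \<open>simp\<close>)
    then have "definable S A k {a. a \<in> tuples k \<and> (\<exists>x \<in> tuples n. x @ a \<in> \<Gamma>)}"
      by (simp add: definable_rel_unary)
    also have "{a. a \<in> tuples k \<and> (\<exists>x \<in> tuples n. x @ a \<in> \<Gamma>)} = carrier Q"
    proof (intro equalityI subsetI)
      fix a assume "a \<in> {a. a \<in> tuples k \<and> (\<exists>x \<in> tuples n. x @ a \<in> \<Gamma>)}"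
      then obtain x where "x \<in> tuples n" "x @ a \<in> \<Gamma>" by blast
      then show "a \<in> carrier Q" using \<Gamma>_iff[of x a] by (simp add: Q_def tuples_def)
    next
      fix a assume "a \<in> carrier Q"
      then obtain x where "x \<in> carrier G" "a = g x" by (auto simp: Q_def)
      then show "a \<in> {a. a \<in> tuples k \<and> (\<exists>x \<in> tuples n. x @ a \<in> \<Gamma>)}"
        using Gt gk \<Gamma>_iff[of x a] Gn by blast
    qed
    finally show ?thesis .
  qed
  moreover have "definable S A (k + k + k) {a @ b @ (a \<otimes>\<^bsub>Q\<^esub> b) | a b. a \<in> carrier Q \<and> b \<in> carrier Q}"
  proof -
    let ?ns = "[n, n, n, k, k, k]"
    have "definable_rel S A ?ns (\<lambda>es. es ! 2 @ es ! 3 \<in> \<Gamma>)"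
      "definable_rel S A ?ns (\<lambda>es. es ! 1 @ es ! 4 \<in> \<Gamma>)"
      "definable_rel S A ?ns (\<lambda>es. es ! 0 @ es ! 5 \<in> \<Gamma>)"
      using definable_rel_mem[OF \<Gamma>, of "[2, 3]" ?ns] definable_rel_mem[OF \<Gamma>, of "[1, 4]" ?ns]
        definable_rel_mem[OF \<Gamma>, of "[0, 5]" ?ns] by (simp_all)
    moreover have "definable_rel S A ?ns (\<lambda>es. es ! 2 @ es ! 1 @ es ! 0 \<in> ?Mult)"
      using definable_rel_mem[OF mult, of "[2, 1, 0]" ?ns] by simp
    ultimately have "definable_rel S A ?ns (\<lambda>es. es ! 2 @ es ! 3 \<in> \<Gamma> \<and> es ! 1 @ es ! 4 \<in> \<Gamma>
        \<and> es ! 0 @ es ! 5 \<in> \<Gamma> \<and> es ! 2 @ es ! 1 @ es ! 0 \<in> ?Mult)"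
      by (intro definable_rel_conj)
    note definable_rel_ex[OF definable_rel_ex[OF definable_rel_ex[OF this]]]
    then have "definable S A (k + k + k) {a @ b @ c | a b c. a \<in> tuples k \<and> b \<in> tuples k \<and> c \<in> tuples k \<and>
      (\<exists>x \<in> tuples n. \<exists>y \<in> tuples n. \<exists>z \<in> tuples n. x @ a \<in> \<Gamma> \<and> y @ b \<in> \<Gamma> \<and> z @ c \<in> \<Gamma> \<and> x @ y @ z \<in> ?Mult)}"
      by (simp add: definable_rel_ternary)
    also have "{a @ b @ c | a b c. a \<in> tuples k \<and> b \<in> tuples k \<and> c \<in> tuples k \<and>
        (\<exists>x \<in> tuples n. \<exists>y \<in> tuples n. \<exists>z \<in> tuples n. x @ a \<in> \<Gamma> \<and> y @ b \<in> \<Gamma> \<and> z @ c \<in> \<Gamma> \<and> x @ y @ z \<in> ?Mult)}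
      = {a @ b @ (a \<otimes>\<^bsub>Q\<^esub> b) | a b. a \<in> carrier Q \<and> b \<in> carrier Q}"
    proof -
      have "a \<in> tuples k \<and> b \<in> tuples k \<and> c \<in> tuples k \<and>
          (\<exists>x \<in> tuples n. \<exists>y \<in> tuples n. \<exists>z \<in> tuples n. x @ a \<in> \<Gamma> \<and> y @ b \<in> \<Gamma> \<and> z @ c \<in> \<Gamma> \<and> x @ y @ z \<in> ?Mult)
        \<longleftrightarrow> a \<in> carrier Q \<and> b \<in> carrier Q \<and> c = a \<otimes>\<^bsub>Q\<^esub> b" (is "?l \<longleftrightarrow> ?r") for a b c
      proof
        assume ?l
        then obtain x y z where "x \<in> tuples n" "y \<in> tuples n" "z \<in> tuples n"
          "x @ a \<in> \<Gamma>" "y @ b \<in> \<Gamma>" "z @ c \<in> \<Gamma>" "x @ y @ z \<in> ?Mult" by blast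
        then have "x \<in> carrier G" "y \<in> carrier G" "a = g x" "b = g y" "c = g (x \<otimes> y)"
          using \<Gamma>_iff[of x a] \<Gamma>_iff[of y b] \<Gamma>_iff[of z c] mult_iff[of x y z] by (simp_all add: tuples_def)
        then show ?r using g_mult by (simp add: Q_def)
      next
        assume ?r
        then obtain x y where xy: "x \<in> carrier G" "y \<in> carrier G" "a = g x" "b = g y" "c = a \<otimes>\<^bsub>Q\<^esub> b"
          by (auto simp: Q_def)
        then have "c = g (x \<otimes> y)" using g_mult by simp
        then have "x @ a \<in> \<Gamma>" "y @ b \<in> \<Gamma>" "(x \<otimes> y) @ c \<in> \<Gamma>" "x @ y @ (x \<otimes> y) \<in> ?Mult"
          using xy \<Gamma>_iff mult_iff Gn Gt by simp_all
        moreover have "a \<in> tuples k" "b \<in> tuples k" "c \<in> tuples k"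
          using xy(3,4) \<open>c = g (x \<otimes> y)\<close> Gt[OF xy(1)] Gt[OF xy(2)] Gt[OF m_closed[OF xy(1,2)]] gk by simp_all
        moreover have "x \<in> tuples n" "y \<in> tuples n" "x \<otimes> y \<in> tuples n"
          using xy Gt by simp_all
        ultimately show ?l by blast
      qed
      then show ?thesis by (simp only:) blast
    qed
    finally show ?thesis .
  qed
  moreover have "{x @ quot_proj G N (\<lambda>X. the_elem (g ` X)) x | x. x \<in> carrier G} = \<Gamma>"
    using proj unfolding \<Gamma>_def by force
  ultimately have "definable_quotient S A n G N k Q (\<lambda>X. the_elem (g ` X))"
    using \<open>group Q\<close> iso \<Gamma> unfolding definable_quotient_def definable_group_def by simp
  then show thesis by (rule that)
qed

section \<open>Definable cochains\<close>

text \<open>Relations are easier to combine than partial functions, and this lemma and the two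
  that follow allow cochains to be given by functional relations.\<close>

lemma definable_pfun_of_relation:
  assumes R: "definable S A (k + n) R"
    and functional: "\<And>x y z. x \<in> tuples k \<Longrightarrow> x @ y \<in> R \<Longrightarrow> x @ z \<in> R \<Longrightarrow> y = z"
  shows "\<exists>h. definable_pfun S A k n h \<and> (\<forall>x \<in> tuples k. \<forall>y. x @ y \<in> R \<longrightarrow> h x = Some y)"
proof -
  define h where "h x = (if x \<in> tuples k \<and> (\<exists>y. x @ y \<in> R) then Some (THE y. x @ y \<in> R) else None)" for x
  have h: "h x = Some y" if "x \<in> tuples k" "x @ y \<in> R" for x y
  proof -
    have "(THE y. x @ y \<in> R) = y" using that(2) functional[OF that(1) _ that(2)] by (rule the_equality)
    then show ?thesis using that unfolding h_def by auto
  qed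
  have hD: "x \<in> tuples k \<and> x @ y \<in> R" if "h x = Some y" for x y
  proof -
    have x: "x \<in> tuples k" "\<exists>y. x @ y \<in> R" using that unfolding h_def by (metis option.distinct(1))+
    then obtain z where "x @ z \<in> R" by blast
    then show ?thesis using h[OF x(1)] that x(1) by simp
  qed
  have R_tuples: "a \<in> tuples (k + n)" if "a \<in> R" for a using definable_tuples[OF R] that by blast
  have "{x @ y | x y. h x = Some y} = R"
  proof (intro equalityI subsetI)
    fix a assume a: "a \<in> R"
    then have "take k a \<in> tuples k" using R_tuples by (simp add: tuples_def)
    then have "h (take k a) = Some (drop k a)" using h a by simp
    then show "a \<in> {x @ y | x y. h x = Some y}" by (metis (mono_tags, lifting) append_take_drop_id mem_Collect_eq)
  qed (use hD in blast)
  moreover have "dom h \<subseteq> tuples k" using hD by (auto simp: dom_def)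
  moreover have "y \<in> tuples n" if "h x = Some y" for x y
    using hD[OF that] R_tuples[of "x @ y"] by (simp add: tuples_def)
  then have "ran h \<subseteq> tuples n" unfolding ran_def by blast
  ultimately have "definable_pfun S A k n h" using R unfolding definable_pfun_def by simp
  then show ?thesis using h by blast
qed

lemma definable_cochainI:
  assumes "definable S A (length a + length a + n) R"
    and "\<And>x y z. x \<in> tuples (length a + length a) \<Longrightarrow> x @ y \<in> R \<Longrightarrow> x @ z \<in> R \<Longrightarrow> y = z"
    and "\<And>\<sigma>. \<sigma> \<in> Aut S A \<Longrightarrow> (a @ map \<sigma> a) @ \<Phi> \<sigma> \<in> R"
  shows "definable_cochain S A \<Phi>"
proof -
  have "\<exists>h. definable_pfun S A (length a + length a) n h
      \<and> (\<forall>x \<in> tuples (length a + length a). \<forall>y. x @ y \<in> R \<longrightarrow> h x = Some y)"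
    by (rule definable_pfun_of_relation[OF assms(1)]) (rule assms(2))
  then obtain h where "definable_pfun S A (length a + length a) n h"
    "\<forall>x \<in> tuples (length a + length a). \<forall>y. x @ y \<in> R \<longrightarrow> h x = Some y"
    by (elim exE conjE)
  moreover have "a @ map \<sigma> a \<in> tuples (length a + length a)" for \<sigma> by (simp add: tuples_def)
  ultimately show ?thesis unfolding definable_cochain_def using assms(3) by blast
qed

lemma definable_cochainE:
  assumes "definable_cochain S A \<Phi>"
  obtains a n R where "definable S A (length a + length a + n) R"
    "\<And>x y z. x \<in> tuples (length a + length a) \<Longrightarrow> x @ y \<in> R \<Longrightarrow> x @ z \<in> R \<Longrightarrow> y = z"
    "\<And>\<sigma>. \<sigma> \<in> Aut S A \<Longrightarrow> (a @ map \<sigma> a) @ \<Phi> \<sigma> \<in> R"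
proof -
  obtain a n h where h: "definable_pfun S A (length a + length a) n h"
    and \<Phi>: "\<And>\<sigma>. \<sigma> \<in> Aut S A \<Longrightarrow> h (a @ map \<sigma> a) = Some (\<Phi> \<sigma>)"
    using assms unfolding definable_cochain_def by blast
  let ?R = "{x @ y | x y. h x = Some y}"
  have iff: "x @ y \<in> ?R \<longleftrightarrow> h x = Some y" if "x \<in> tuples (length a + length a)" for x y
  proof
    assume "x @ y \<in> ?R"
    then obtain x' y' where eq: "x @ y = x' @ y'" "h x' = Some y'" by blast
    then have "x' \<in> tuples (length a + length a)" using h unfolding definable_pfun_def by blast
    then have "length x = length x'" using that by (simp add: tuples_def)
    then show "h x = Some y" using eq by simp
  qed blast
  show thesis
  proof (rule that)
    show "definable S A (length a + length a + n) ?R" using h unfolding definable_pfun_def by blast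
    show "y = z" if "x \<in> tuples (length a + length a)" "x @ y \<in> ?R" "x @ z \<in> ?R" for x y z
    proof -
      have "h x = Some y" "h x = Some z"
        by (rule iffD1[OF iff[OF that(1)] that(2)], rule iffD1[OF iff[OF that(1)] that(3)])
      then show ?thesis by simp
    qed
    show "(a @ map \<sigma> a) @ \<Phi> \<sigma> \<in> ?R" if "\<sigma> \<in> Aut S A" for \<sigma>
      using \<Phi>[OF that] by blast
  qed
qed

lemma definable_cochain_cong:
  assumes "\<And>\<sigma>. \<sigma> \<in> Aut S A \<Longrightarrow> \<Phi> \<sigma> = \<Psi> \<sigma>"
  shows "definable_cochain S A \<Phi> \<longleftrightarrow> definable_cochain S A \<Psi>"
  unfolding definable_cochain_def using assms by (simp cong: ball_cong)

lemma diagonal_iff: "x @ y \<in> {x @ x | x. x \<in> tuples n} \<longleftrightarrow> x = y" if "x \<in> tuples n" "y \<in> tuples n"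
proof
  assume "x @ y \<in> {x @ x | x. x \<in> tuples n}"
  then obtain z where "x @ y = z @ z" "z \<in> tuples n" by blast
  then show "x = y" using that by (simp add: tuples_def)
qed (use that in blast)

lemma definable_cochain_of_rel:
  assumes P: "definable_rel S A [length a, length a, n] (\<lambda>es. P (es ! 0) (es ! 1) (es ! 2))"
    and functional: "\<And>x y z w. x \<in> tuples (length a) \<Longrightarrow> y \<in> tuples (length a) \<Longrightarrow>
      z \<in> tuples n \<Longrightarrow> w \<in> tuples n \<Longrightarrow> P x y z \<Longrightarrow> P x y w \<Longrightarrow> z = w"
    and cochain: "\<And>\<sigma>. \<sigma> \<in> Aut S A \<Longrightarrow> \<Phi> \<sigma> \<in> tuples n \<and> P a (map \<sigma> a) (\<Phi> \<sigma>)"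
  shows "definable_cochain S A \<Phi>"
proof -
  let ?l = "length a"
  define R where "R = {x @ y @ z | x y z. x \<in> tuples ?l \<and> y \<in> tuples ?l \<and> z \<in> tuples n \<and> P x y z}"
  have "definable S A (?l + ?l + n) R"
    using P unfolding R_def by (simp add: definable_rel_ternary)
  moreover have R_D: "z \<in> tuples n \<and> P (take ?l v) (drop ?l v) z"
    if "v @ z \<in> R" "v \<in> tuples (?l + ?l)" for v z
  proof -
    obtain x y w where eq: "v @ z = x @ y @ w" and xyw: "x \<in> tuples ?l" "y \<in> tuples ?l" "w \<in> tuples n" "P x y w"
      using \<open>v @ z \<in> R\<close> unfolding R_def by blast
    have "length v = length (x @ y)" using that(2) xyw by (simp add: tuples_def)
    moreover have "v @ z = (x @ y) @ w" using eq by simp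
    ultimately have "v = x @ y" "z = w" using append_eq_append_conv by blast+
    then show ?thesis using xyw by (simp add: tuples_def)
  qed
  moreover have "y = z" if "v \<in> tuples (?l + ?l)" "v @ y \<in> R" "v @ z \<in> R" for v y z
  proof (rule functional)
    show "take ?l v \<in> tuples ?l" "drop ?l v \<in> tuples ?l" using that(1) by (simp_all add: tuples_def)
  qed (use R_D[OF that(2,1)] R_D[OF that(3,1)] in simp_all)
  moreover have "(a @ map \<sigma> a) @ \<Phi> \<sigma> \<in> R" if "\<sigma> \<in> Aut S A" for \<sigma>
  proof -
    have "a \<in> tuples ?l" "map \<sigma> a \<in> tuples ?l" by (simp_all add: tuples_def)
    then show ?thesis unfolding R_def append_assoc using cochain[OF that] by blast
  qed
  ultimately show ?thesis by (intro definable_cochainI)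
qed

lemma definable_cochain_const: "definable_cochain S A (\<lambda>\<sigma>. b)"
proof (rule definable_cochain_of_rel)
  show "definable_rel S A [length b, length b, length b]
      (\<lambda>es. es ! 0 @ es ! 2 \<in> {x @ x | x. x \<in> tuples (length b)})"
    using definable_rel_mem[OF definable_diagonal, of "[0, 2]" "[length b, length b, length b]" "length b"]
    by simp
  show "b \<in> tuples (length b) \<and> b @ b \<in> {x @ x | x. x \<in> tuples (length b)}" for \<sigma> :: "'b \<Rightarrow> 'b"
    by (auto simp: tuples_def)
qed (simp only: diagonal_iff)

lemma definable_cochain_orbit: "definable_cochain S A (\<lambda>\<sigma>. map \<sigma> b)"
proof (rule definable_cochain_of_rel)
  show "definable_rel S A [length b, length b, length b]
      (\<lambda>es. es ! 1 @ es ! 2 \<in> {x @ x | x. x \<in> tuples (length b)})"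
    using definable_rel_mem[OF definable_diagonal, of "[1, 2]" "[length b, length b, length b]" "length b"]
    by simp
  show "map \<sigma> b \<in> tuples (length b) \<and> map \<sigma> b @ map \<sigma> b \<in> {x @ x | x. x \<in> tuples (length b)}" for \<sigma>
    by (auto simp: tuples_def)
qed (simp only: diagonal_iff)

text \<open>If the values of \<open>\<Phi>\<close> and \<open>\<Psi>\<close> are determined by \<open>a, \<sigma>(a)\<close> and by \<open>b, \<sigma>(b)\<close>, then any definable function
  of the two values is determined by \<open>ab, \<sigma>(ab)\<close>.\<close>

lemma definable_cochain_combine:
  assumes "definable_cochain S A \<Phi>" "definable_cochain S A \<Psi>"
    and F: "definable_rel S A [m, n, k] (\<lambda>es. F (es ! 0) (es ! 1) (es ! 2))"
    and functional: "\<And>x y z w. x \<in> tuples m \<Longrightarrow> y \<in> tuples n \<Longrightarrow> z \<in> tuples k \<Longrightarrow> w \<in> tuples k \<Longrightarrow>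
      F x y z \<Longrightarrow> F x y w \<Longrightarrow> z = w"
    and vals: "\<And>\<sigma>. \<sigma> \<in> Aut S A \<Longrightarrow> \<Phi> \<sigma> \<in> tuples m"
      "\<And>\<sigma>. \<sigma> \<in> Aut S A \<Longrightarrow> \<Psi> \<sigma> \<in> tuples n"
      "\<And>\<sigma>. \<sigma> \<in> Aut S A \<Longrightarrow> \<Lambda> \<sigma> \<in> tuples k"
      "\<And>\<sigma>. \<sigma> \<in> Aut S A \<Longrightarrow> F (\<Phi> \<sigma>) (\<Psi> \<sigma>) (\<Lambda> \<sigma>)"
  shows "definable_cochain S A \<Lambda>"
proof -
  define \<Gamma> where "\<Gamma> = {x @ y @ z | x y z. x \<in> tuples m \<and> y \<in> tuples n \<and> z \<in> tuples k \<and> F x y z}"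
  have \<Gamma>: "definable S A (m + n + k) \<Gamma>" using F unfolding \<Gamma>_def by (simp add: definable_rel_ternary)
  have \<Gamma>_iff: "x @ y @ z \<in> \<Gamma> \<longleftrightarrow> z \<in> tuples k \<and> F x y z" if "x \<in> tuples m" "y \<in> tuples n" for x y z
  proof
    assume "x @ y @ z \<in> \<Gamma>"
    then obtain x' y' z' where eq: "x @ y @ z = x' @ y' @ z'" "x' \<in> tuples m" "y' \<in> tuples n"
      "z' \<in> tuples k" "F x' y' z'" unfolding \<Gamma>_def by blast
    then have "x = x'" "y = y'" "z = z'" using that by (simp_all add: tuples_def)
    then show "z \<in> tuples k \<and> F x y z" using eq(4,5) by simp
  qed (use that in \<open>auto simp: \<Gamma>_def\<close>)
  obtain a m' R where R: "definable S A (length a + length a + m') R"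
    and R_fun: "\<And>x y z. x \<in> tuples (length a + length a) \<Longrightarrow> x @ y \<in> R \<Longrightarrow> x @ z \<in> R \<Longrightarrow> y = z"
    and R_\<Phi>: "\<And>\<sigma>. \<sigma> \<in> Aut S A \<Longrightarrow> (a @ map \<sigma> a) @ \<Phi> \<sigma> \<in> R"
    using definable_cochainE[OF assms(1)] by blast
  obtain b n' T where T: "definable S A (length b + length b + n') T"
    and T_fun: "\<And>x y z. x \<in> tuples (length b + length b) \<Longrightarrow> x @ y \<in> T \<Longrightarrow> x @ z \<in> T \<Longrightarrow> y = z"
    and T_\<Psi>: "\<And>\<sigma>. \<sigma> \<in> Aut S A \<Longrightarrow> (b @ map \<sigma> b) @ \<Psi> \<sigma> \<in> T"
    using definable_cochainE[OF assms(2)] by blast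
  \<comment> \<open>The lengths of values in the two descriptions agree with \<open>m\<close> and \<open>n\<close> since there is at least one
    automorphism to compare them at.\<close>
  have "(a @ map id a) @ \<Phi> id \<in> tuples (length a + length a + m')"
    using R_\<Phi>[OF id_Aut] definable_tuples[OF R] by blast
  then have m': "m' = m" using vals(1)[OF id_Aut] by (simp add: tuples_def)
  have "(b @ map id b) @ \<Psi> id \<in> tuples (length b + length b + n')"
    using T_\<Psi>[OF id_Aut] definable_tuples[OF T] by blast
  then have n': "n' = n" using vals(2)[OF id_Aut] by (simp add: tuples_def)
  let ?i = "length a" and ?j = "length b"
  let ?ns = "[?i, ?j, ?i, ?j, k]"
  \<comment> \<open>The blocks of the new relation are, in this order, \<open>a\<close>, \<open>b\<close>, \<open>\<sigma>(a)\<close>, \<open>\<sigma>(b)\<close> and the value.\<close>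
  define P where "P es \<longleftrightarrow> (\<exists>x \<in> tuples m. \<exists>y \<in> tuples n.
    es ! 0 @ es ! 2 @ x \<in> R \<and> es ! 1 @ es ! 3 @ y \<in> T \<and> x @ y @ es ! 4 \<in> \<Gamma>)" for es
  have P_iff: "P [p, q, p', q', z] \<longleftrightarrow> (\<exists>x \<in> tuples m. \<exists>y \<in> tuples n.
    p @ p' @ x \<in> R \<and> q @ q' @ y \<in> T \<and> x @ y @ z \<in> \<Gamma>)" for p q p' q' z
    by (simp add: P_def)
  define U where "U = concat ` {es. map length es = ?ns \<and> P es}"
  have "definable_rel S A (n # m # ?ns) (\<lambda>es. es ! 2 @ es ! 4 @ es ! 1 \<in> R)"
    using definable_rel_mem[OF R[unfolded m'], of "[2, 4, 1]" "n # m # ?ns"] by simp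
  moreover have "definable_rel S A (n # m # ?ns) (\<lambda>es. es ! 3 @ es ! 5 @ es ! 0 \<in> T)"
    using definable_rel_mem[OF T[unfolded n'], of "[3, 5, 0]" "n # m # ?ns"] by simp
  moreover have "definable_rel S A (n # m # ?ns) (\<lambda>es. es ! 1 @ es ! 0 @ es ! 6 \<in> \<Gamma>)"
    using definable_rel_mem[OF \<Gamma>, of "[1, 0, 6]" "n # m # ?ns"] by simp
  ultimately have "definable_rel S A (n # m # ?ns) (\<lambda>es. es ! 2 @ es ! 4 @ es ! 1 \<in> R
      \<and> es ! 3 @ es ! 5 @ es ! 0 \<in> T \<and> es ! 1 @ es ! 0 @ es ! 6 \<in> \<Gamma>)"
    by (intro definable_rel_conj)
  from definable_rel_ex[OF definable_rel_ex[OF this]]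
  have "definable_rel S A ?ns P" by (simp add: P_def [abs_def])
  then have U: "definable S A (length (a @ b) + length (a @ b) + k) U"
    unfolding definable_rel_def U_def by (simp add: algebra_simps)
  have U_iff: "p @ q @ p' @ q' @ z \<in> U \<longleftrightarrow> z \<in> tuples k \<and> P [p, q, p', q', z]"
    if "length p = ?i" "length q = ?j" "length p' = ?i" "length q' = ?j" for p q p' q' z
  proof (cases "z \<in> tuples k")
    case True
    have "concat [p, q, p', q', z] \<in> U \<longleftrightarrow> [p, q, p', q', z] \<in> {es. map length es = ?ns \<and> P es}"
      unfolding U_def by (rule inj_on_image_mem_iff[OF inj_on_concat_same_shape[of ?ns]])
        (use that True in \<open>auto simp: tuples_def\<close>)
    then show ?thesis using that True by (simp add: tuples_def)
  next
    case False
    have "U \<subseteq> tuples (sum_list ?ns)"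
      unfolding U_def tuples_sum_list by (intro image_mono Collect_mono impI) (erule conjunct1)
    moreover have "p @ q @ p' @ q' @ z \<notin> tuples (sum_list ?ns)" using that False by (simp add: tuples_def)
    ultimately show ?thesis using False by blast
  qed
  show ?thesis
  proof (rule definable_cochainI[OF U])
    fix v z w assume v: "v \<in> tuples (length (a @ b) + length (a @ b))" and zw: "v @ z \<in> U" "v @ w \<in> U"
    have "v \<in> tuples (sum_list [?i, ?j, ?i, ?j])" using v by (simp add: algebra_simps)
    then have "v \<in> concat ` {es. map length es = [?i, ?j, ?i, ?j]}" by (simp only: tuples_sum_list)
    then obtain es where es: "v = concat es" "map length es = [?i, ?j, ?i, ?j]"
      by (elim imageE CollectE)
    from es(2) obtain p q p' q' where "es = [p, q, p', q']"
      and len: "length p = ?i" "length q = ?j" "length p' = ?i" "length q' = ?j"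
      by (auto simp only: map_eq_Cons_conv Nil_is_map_conv list.map)
    then have pq: "v = p @ q @ p' @ q'" using es(1) by simp
    have z: "P [p, q, p', q', z]" and w: "P [p, q, p', q', w]"
      using U_iff[OF len] zw unfolding pq append_assoc by blast+
    from z obtain x y where xy: "x \<in> tuples m" "y \<in> tuples n" "(p @ p') @ x \<in> R" "(q @ q') @ y \<in> T" "x @ y @ z \<in> \<Gamma>"
      unfolding P_iff append_assoc by blast
    from w obtain x' y' where xy': "(p @ p') @ x' \<in> R" "(q @ q') @ y' \<in> T" "x' @ y' @ w \<in> \<Gamma>"
      unfolding P_iff append_assoc by blast
    have "x = x'" using R_fun[OF _ xy(3) xy'(1)] len by (simp add: tuples_def)
    moreover have "y = y'" using T_fun[OF _ xy(4) xy'(2)] len by (simp add: tuples_def)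
    ultimately show "z = w"
      using functional[OF xy(1,2), of z w] xy(5) xy'(3) \<Gamma>_iff[OF xy(1,2)] by blast
  next
    fix \<sigma> assume \<sigma>: "\<sigma> \<in> Aut S A"
    have "\<Phi> \<sigma> @ \<Psi> \<sigma> @ \<Lambda> \<sigma> \<in> \<Gamma>"
      using \<Gamma>_iff[OF vals(1,2)[OF \<sigma>]] vals(3,4)[OF \<sigma>] by blast
    then have "P [a, b, map \<sigma> a, map \<sigma> b, \<Lambda> \<sigma>]"
      using vals[OF \<sigma>] R_\<Phi>[OF \<sigma>] T_\<Psi>[OF \<sigma>] unfolding P_iff append_assoc by blast
    then have "a @ b @ map \<sigma> a @ map \<sigma> b @ \<Lambda> \<sigma> \<in> U"
      using U_iff[of a b "map \<sigma> a" "map \<sigma> b" "\<Lambda> \<sigma>"] vals(3)[OF \<sigma>] by (simp only: length_map)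
    then show "((a @ b) @ map \<sigma> (a @ b)) @ \<Lambda> \<sigma> \<in> U" by (simp only: map_append append_assoc)
  qed
qed

lemma definable_cochain_mult:
  assumes G: "definable_group S A n G"
    and "definable_cochain S A \<Phi>" "definable_cochain S A \<Psi>"
    and vals: "\<And>\<sigma>. \<sigma> \<in> Aut S A \<Longrightarrow> \<Phi> \<sigma> \<in> carrier G" "\<And>\<sigma>. \<sigma> \<in> Aut S A \<Longrightarrow> \<Psi> \<sigma> \<in> carrier G"
  shows "definable_cochain S A (\<lambda>\<sigma>. \<Phi> \<sigma> \<otimes>\<^bsub>G\<^esub> \<Psi> \<sigma>)"
proof (rule definable_cochain_combine[OF assms(2,3)])
  interpret group G using G unfolding definable_group_def by blast
  note tup = definable_group_tuples[OF G]
  show "definable_rel S A [n, n, n] (\<lambda>es. es ! 0 @ es ! 1 @ es ! 2 \<in> mult_graph G)"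
    using definable_rel_mem[OF definable_mult_graph[OF G], of "[0, 1, 2]" "[n, n, n]"] by simp
  show "z = w" if "x \<in> tuples n" "y \<in> tuples n" "x @ y @ z \<in> mult_graph G" "x @ y @ w \<in> mult_graph G"
    for x y z w using that by (simp add: mult_graph_iff[OF G])
  show "\<Phi> \<sigma> \<in> tuples n" "\<Psi> \<sigma> \<in> tuples n" "\<Phi> \<sigma> \<otimes>\<^bsub>G\<^esub> \<Psi> \<sigma> \<in> tuples n"
    "\<Phi> \<sigma> @ \<Psi> \<sigma> @ \<Phi> \<sigma> \<otimes>\<^bsub>G\<^esub> \<Psi> \<sigma> \<in> mult_graph G" if "\<sigma> \<in> Aut S A" for \<sigma>
    using vals[OF that] tup by (simp_all add: mult_graph_iff[OF G])
qed

text \<open>The quotient \<open>z = x y\<inverse>\<close> is defined by \<open>z y = x\<close>, that is, by the multiplication graph with the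
  blocks in reverse order.\<close>

lemma definable_cochain_divide:
  assumes G: "definable_group S A n G"
    and "definable_cochain S A \<Phi>" "definable_cochain S A \<Psi>"
    and vals: "\<And>\<sigma>. \<sigma> \<in> Aut S A \<Longrightarrow> \<Phi> \<sigma> \<in> carrier G" "\<And>\<sigma>. \<sigma> \<in> Aut S A \<Longrightarrow> \<Psi> \<sigma> \<in> carrier G"
  shows "definable_cochain S A (\<lambda>\<sigma>. \<Phi> \<sigma> \<otimes>\<^bsub>G\<^esub> inv\<^bsub>G\<^esub> (\<Psi> \<sigma>))"
proof (rule definable_cochain_combine[OF assms(2,3)])
  interpret group G using G unfolding definable_group_def by blast
  note tup = definable_group_tuples[OF G]
  show "definable_rel S A [n, n, n] (\<lambda>es. es ! 2 @ es ! 1 @ es ! 0 \<in> mult_graph G)"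
    using definable_rel_mem[OF definable_mult_graph[OF G], of "[2, 1, 0]" "[n, n, n]"] by simp
  show "z = w" if "y \<in> tuples n" "z \<in> tuples n" "w \<in> tuples n"
      "z @ y @ x \<in> mult_graph G" "w @ y @ x \<in> mult_graph G" for x y z w
  proof -
    have "z \<in> carrier G" "w \<in> carrier G" "y \<in> carrier G" "z \<otimes>\<^bsub>G\<^esub> y = w \<otimes>\<^bsub>G\<^esub> y"
      using that by (simp_all add: mult_graph_iff[OF G])
    then show ?thesis by (simp add: right_cancel)
  qed
  show "\<Phi> \<sigma> \<in> tuples n" "\<Psi> \<sigma> \<in> tuples n" "\<Phi> \<sigma> \<otimes>\<^bsub>G\<^esub> inv\<^bsub>G\<^esub> \<Psi> \<sigma> \<in> tuples n"
    "(\<Phi> \<sigma> \<otimes>\<^bsub>G\<^esub> inv\<^bsub>G\<^esub> \<Psi> \<sigma>) @ \<Psi> \<sigma> @ \<Phi> \<sigma> \<in> mult_graph G" if "\<sigma> \<in> Aut S A" for \<sigma>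
    using vals[OF that] tup by (simp_all add: mult_graph_iff[OF G] m_assoc)
qed

text \<open>A unary map is treated as a binary one that ignores its first argument.\<close>

lemma definable_cochain_map:
  assumes \<Phi>: "definable_cochain S A \<Phi>" "\<And>\<sigma>. \<sigma> \<in> Aut S A \<Longrightarrow> \<Phi> \<sigma> \<in> X"
    and X: "X \<subseteq> tuples n" and graph: "definable S A (n + k) {x @ f x | x. x \<in> X}"
  shows "definable_cochain S A (\<lambda>\<sigma>. f (\<Phi> \<sigma>))"
proof -
  define \<Gamma> where "\<Gamma> = {x @ f x | x. x \<in> X}"
  have \<Gamma>: "definable S A (n + k) \<Gamma>" using graph unfolding \<Gamma>_def .
  have iff: "x @ z \<in> \<Gamma> \<longleftrightarrow> x \<in> X \<and> z = f x" if "x \<in> tuples n" for x z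
  proof
    assume "x @ z \<in> \<Gamma>"
    then obtain y where y: "x @ z = y @ f y" "y \<in> X" unfolding \<Gamma>_def by blast
    then have "y \<in> tuples n" using X by blast
    then have "length x = length y" using that by (simp add: tuples_def)
    then show "x \<in> X \<and> z = f x" using y by simp
  qed (auto simp: \<Gamma>_def)
  show ?thesis
  proof (rule definable_cochain_combine[OF \<Phi>(1) \<Phi>(1)])
    show "definable_rel S A [n, n, k] (\<lambda>es. es ! 1 @ es ! 2 \<in> \<Gamma>)"
      using definable_rel_mem[OF \<Gamma>, of "[1, 2]" "[n, n, k]"] by simp
    show "z = w" if "y \<in> tuples n" "y @ z \<in> \<Gamma>" "y @ w \<in> \<Gamma>" for y z w
      using that by (simp add: iff)
  next
    fix \<sigma> assume "\<sigma> \<in> Aut S A"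
    then have c: "\<Phi> \<sigma> \<in> X" "\<Phi> \<sigma> \<in> tuples n" using \<Phi>(2) X by blast+
    show "\<Phi> \<sigma> \<in> tuples n" "\<Phi> \<sigma> \<in> tuples n" by (rule c(2))+
    show "\<Phi> \<sigma> @ f (\<Phi> \<sigma>) \<in> \<Gamma>" using c by (simp add: iff)
    then have "\<Phi> \<sigma> @ f (\<Phi> \<sigma>) \<in> tuples (n + k)" using definable_tuples[OF \<Gamma>] by blast
    then show "f (\<Phi> \<sigma>) \<in> tuples k" using c(2) by (simp add: tuples_def)
  qed
qed

section \<open>Cohomology classes\<close>

lemma (in group) cancel_inv:
  assumes "x \<in> carrier G" "y \<in> carrier G"
  shows "x \<otimes> (inv x \<otimes> y) = y" "inv x \<otimes> (x \<otimes> y) = y"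
  using assms by (simp_all flip: m_assoc)

text \<open>Stated for an arbitrary action by homomorphisms: it is applied to the natural actions on \<open>G\<close> and on its
  quotient and to the twisted action on \<open>N\<close>. Reflexivity, symmetry and transitivity are witnessed
  by \<open>1\<close>, \<open>b\<inverse>\<close> and \<open>b c\<close>.\<close>

lemma equiv_cohomologous:
  fixes G (structure)
  assumes "group G" and act: "\<And>\<sigma>. \<sigma> \<in> Aut S A \<Longrightarrow> act \<sigma> \<in> hom G G"
  shows "equiv (Z1 S A G act) (cohomologous S A G act)"
proof -
  interpret group G by fact
  have act_hom: "group_hom G G (act \<sigma>)" if "\<sigma> \<in> Aut S A" for \<sigma>
    using act[OF that] is_group by (intro group_hom.intro group_hom_axioms.intro)
  have act_simps: "act \<sigma> \<one> = \<one>" "\<And>x. x \<in> carrier G \<Longrightarrow> act \<sigma> x \<in> carrier G"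
    "\<And>x. x \<in> carrier G \<Longrightarrow> act \<sigma> (inv x) = inv (act \<sigma> x)"
    "\<And>x y. x \<in> carrier G \<Longrightarrow> y \<in> carrier G \<Longrightarrow> act \<sigma> (x \<otimes> y) = act \<sigma> x \<otimes> act \<sigma> y"
    if "\<sigma> \<in> Aut S A" for \<sigma>
    using group_hom.hom_one[OF act_hom[OF that]] group_hom.hom_closed[OF act_hom[OF that]]
      group_hom.hom_inv[OF act_hom[OF that]] group_hom.hom_mult[OF act_hom[OF that]] by blast+
  have val: "\<Phi> \<sigma> \<in> carrier G" if "\<Phi> \<in> Z1 S A G act" "\<sigma> \<in> Aut S A" for \<Phi> \<sigma>
    using that unfolding Z1_def by blast
  show ?thesis
  proof (rule equivI)
    show "cohomologous S A G act \<subseteq> Z1 S A G act \<times> Z1 S A G act"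
      unfolding cohomologous_def by blast
    show "refl_on (Z1 S A G act) (cohomologous S A G act)"
    proof (rule refl_onI)
      fix \<Phi> assume \<Phi>: "\<Phi> \<in> Z1 S A G act"
      then have "\<Phi> \<sigma> = inv \<one> \<otimes> \<Phi> \<sigma> \<otimes> act \<sigma> \<one>" if "\<sigma> \<in> Aut S A" for \<sigma>
        using val[OF \<Phi> that] act_simps[OF that] by simp
      then show "(\<Phi>, \<Phi>) \<in> cohomologous S A G act"
        using \<Phi> one_closed unfolding cohomologous_def by blast
    qed
    show "sym (cohomologous S A G act)"
    proof (rule symI)
      fix \<Phi> \<Psi> assume "(\<Phi>, \<Psi>) \<in> cohomologous S A G act"
      then obtain b where Z: "\<Phi> \<in> Z1 S A G act" "\<Psi> \<in> Z1 S A G act" and b: "b \<in> carrier G"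
        and eq: "\<And>\<sigma>. \<sigma> \<in> Aut S A \<Longrightarrow> \<Psi> \<sigma> = inv b \<otimes> \<Phi> \<sigma> \<otimes> act \<sigma> b"
        unfolding cohomologous_def by blast
      have "\<Phi> \<sigma> = inv (inv b) \<otimes> \<Psi> \<sigma> \<otimes> act \<sigma> (inv b)" if "\<sigma> \<in> Aut S A" for \<sigma>
        using eq[OF that] val[OF Z(1) that] b act_simps[OF that] by (simp add: m_assoc cancel_inv)
      then show "(\<Psi>, \<Phi>) \<in> cohomologous S A G act"
        using Z inv_closed[OF b] unfolding cohomologous_def by blast
    qed
    show "trans (cohomologous S A G act)"
    proof (rule transI)
      fix \<Phi> \<Psi> \<Lambda>
      assume "(\<Phi>, \<Psi>) \<in> cohomologous S A G act" "(\<Psi>, \<Lambda>) \<in> cohomologous S A G act"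
      then obtain b c where Z: "\<Phi> \<in> Z1 S A G act" "\<Lambda> \<in> Z1 S A G act"
        and bc: "b \<in> carrier G" "c \<in> carrier G"
        and eq: "\<And>\<sigma>. \<sigma> \<in> Aut S A \<Longrightarrow> \<Psi> \<sigma> = inv b \<otimes> \<Phi> \<sigma> \<otimes> act \<sigma> b"
          "\<And>\<sigma>. \<sigma> \<in> Aut S A \<Longrightarrow> \<Lambda> \<sigma> = inv c \<otimes> \<Psi> \<sigma> \<otimes> act \<sigma> c"
        unfolding cohomologous_def by blast
      have "\<Lambda> \<sigma> = inv (b \<otimes> c) \<otimes> \<Phi> \<sigma> \<otimes> act \<sigma> (b \<otimes> c)" if "\<sigma> \<in> Aut S A" for \<sigma>
        using eq[OF that] val[OF Z(1) that] bc act_simps[OF that] by (simp add: m_assoc inv_mult_group)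
      then show "(\<Phi>, \<Lambda>) \<in> cohomologous S A G act"
        using Z m_closed[OF bc] unfolding cohomologous_def by blast
    qed
  qed
qed

lemma H1_memD:
  assumes "equiv (Z1 S A G act) (cohomologous S A G act)" "\<mu> \<in> H1 S A G act" "\<Phi> \<in> \<mu>"
  shows "\<Phi> \<in> Z1 S A G act" "\<mu> = coh_class S A G act \<Phi>"
proof -
  obtain \<Psi> where \<Psi>: "\<Psi> \<in> Z1 S A G act" "\<mu> = coh_class S A G act \<Psi>"
    using assms(2) unfolding H1_def coh_class_def by (elim quotientE)
  then have "(\<Psi>, \<Phi>) \<in> cohomologous S A G act" using assms(3) by (simp add: coh_class_def)
  then show "\<Phi> \<in> Z1 S A G act" "\<mu> = coh_class S A G act \<Phi>"
    using \<Psi>(2) equiv_class_eq[OF assms(1)] by (auto simp: coh_class_def cohomologous_def)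
qed

lemma coh_class_eq_iff:
  assumes "equiv (Z1 S A G act) (cohomologous S A G act)" "\<Phi> \<in> Z1 S A G act" "\<Psi> \<in> Z1 S A G act"
  shows "coh_class S A G act \<Phi> = coh_class S A G act \<Psi> \<longleftrightarrow> (\<Phi>, \<Psi>) \<in> cohomologous S A G act"
  unfolding coh_class_def using eq_equiv_class_iff[OF assms] .

lemma coh_class_in_H1: "\<Phi> \<in> Z1 S A G act \<Longrightarrow> coh_class S A G act \<Phi> \<in> H1 S A G act"
  unfolding H1_def coh_class_def by (rule quotientI)

lemma trivial_cocycle:
  assumes "group G" "\<And>\<sigma>. \<sigma> \<in> Aut S A \<Longrightarrow> act \<sigma> \<in> hom G G"
  shows "(\<lambda>\<sigma> \<in> Aut S A. \<one>\<^bsub>G\<^esub>) \<in> Z1 S A G act"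
proof -
  interpret group G by fact
  have "definable_cochain S A (\<lambda>\<sigma> \<in> Aut S A. \<one>\<^bsub>G\<^esub>)"
    using definable_cochain_const by (rule iffD2[OF definable_cochain_cong, rotated]) simp
  moreover have "act \<sigma> \<one>\<^bsub>G\<^esub> = \<one>\<^bsub>G\<^esub>" if "\<sigma> \<in> Aut S A" for \<sigma>
    using hom_one[OF assms(2)[OF that]] is_group by blast
  ultimately show ?thesis unfolding Z1_def by (auto simp: comp_Aut)
qed

text \<open>An automorphism over \<open>A\<close> preserves the carrier and the multiplication graph.\<close>

lemma Aut_hom:
  assumes G: "definable_group S A n G" and \<sigma>: "\<sigma> \<in> Aut S A"
  shows "map \<sigma> \<in> hom G G"
proof -
  note tup = definable_group_tuples[OF G]
  have carr: "definable S A n (carrier G)" using G unfolding definable_group_def by blast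
  have closed: "map \<sigma> x \<in> carrier G" if "x \<in> carrier G" for x
    using definable_Aut[OF \<sigma> carr, of x] tup[OF that] that by (simp add: tuples_def)
  have "map \<sigma> (x \<otimes>\<^bsub>G\<^esub> y) = map \<sigma> x \<otimes>\<^bsub>G\<^esub> map \<sigma> y" if "x \<in> carrier G" "y \<in> carrier G" for x y
  proof -
    interpret group G using G unfolding definable_group_def by blast
    have "x @ y @ (x \<otimes>\<^bsub>G\<^esub> y) \<in> mult_graph G" using that unfolding mult_graph_def by blast
    moreover have "length (x @ y @ (x \<otimes>\<^bsub>G\<^esub> y)) = n + n + n"
      using tup[OF that(1)] tup[OF that(2)] tup[OF m_closed[OF that]] by (simp add: tuples_def)
    ultimately have "map \<sigma> (x @ y @ (x \<otimes>\<^bsub>G\<^esub> y)) \<in> mult_graph G"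
      using definable_Aut[OF \<sigma> definable_mult_graph[OF G]] by blast
    then show ?thesis
      using mult_graph_iff[OF G tup[OF closed[OF that(1)]] tup[OF closed[OF that(2)]]] by simp
  qed
  then show ?thesis using closed unfolding hom_def by blast
qed

section \<open>The fibre of an extension\<close>

text \<open>The extension of the group \<open>Q\<close> by \<open>N\<close>, with \<open>Q\<close> any definable copy of the quotient.\<close>

locale definable_extension = normal N G for N and G :: "'m list monoid" (structure) +
  fixes S :: "('f, 'r, 'm) fo_struct" and A :: "'m set" and n k :: nat
    and Q :: "'m list monoid" and \<iota> :: "'m list set \<Rightarrow> 'm list"
  assumes G_definable: "definable_group S A n G"
    and N_definable: "definable S A n N"
    and quotient: "definable_quotient S A n G N k Q \<iota>"
begin

abbreviation proj where "proj \<equiv> quot_proj G N \<iota>"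

abbreviation subgroup_N where "subgroup_N \<equiv> G\<lparr>carrier := N\<rparr>"

lemma Q_definable: "definable_group S A k Q"
  using quotient unfolding definable_quotient_def by blast

lemma act_G: "\<sigma> \<in> Aut S A \<Longrightarrow> map \<sigma> \<in> hom G G"
  using Aut_hom[OF G_definable] .

lemma act_Q: "\<sigma> \<in> Aut S A \<Longrightarrow> map \<sigma> \<in> hom Q Q"
  using Aut_hom[OF Q_definable] .

lemma group_Q: "group Q"
  using Q_definable unfolding definable_group_def by blast

lemma equiv_G: "equiv (Z1 S A G map) (cohomologous S A G map)"
  using is_group act_G by (rule equiv_cohomologous)

lemma equiv_Q: "equiv (Z1 S A Q map) (cohomologous S A Q map)"
  using group_Q act_Q by (rule equiv_cohomologous)

lemma act_simps:
  assumes "\<sigma> \<in> Aut S A"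
  shows "x \<in> carrier G \<Longrightarrow> map \<sigma> x \<in> carrier G"
    "x \<in> carrier G \<Longrightarrow> map \<sigma> (inv x) = inv (map \<sigma> x)"
    "x \<in> carrier G \<Longrightarrow> y \<in> carrier G \<Longrightarrow> map \<sigma> (x \<otimes> y) = map \<sigma> x \<otimes> map \<sigma> y"
proof -
  have gh: "group_hom G G (map \<sigma>)"
    using act_G[OF assms] is_group by (intro group_hom.intro group_hom_axioms.intro)
  show "x \<in> carrier G \<Longrightarrow> map \<sigma> x \<in> carrier G"
    "x \<in> carrier G \<Longrightarrow> map \<sigma> (inv x) = inv (map \<sigma> x)"
    "x \<in> carrier G \<Longrightarrow> y \<in> carrier G \<Longrightarrow> map \<sigma> (x \<otimes> y) = map \<sigma> x \<otimes> map \<sigma> y"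
    using group_hom.hom_closed[OF gh] group_hom.hom_inv[OF gh] group_hom.hom_mult[OF gh] by blast+
qed

lemma act_N: "\<sigma> \<in> Aut S A \<Longrightarrow> x \<in> N \<Longrightarrow> map \<sigma> x \<in> N"
  using definable_Aut[OF _ N_definable, of \<sigma> x] definable_tuples[OF N_definable] by (auto simp: tuples_def)

lemma proj_hom: "group_hom G Q proj"
proof -
  have "\<iota> \<in> hom (G Mod N) Q"
    using quotient unfolding definable_quotient_def iso_def by blast
  then have "\<iota> \<circ> (\<lambda>a. N #> a) \<in> hom G Q" by (rule Group.hom_compose[OF r_coset_hom_Mod])
  then have "proj \<in> hom G Q" by (simp add: quot_proj_def[abs_def] o_def)
  then show ?thesis using is_group group_Q by (intro group_hom.intro group_hom_axioms.intro)
qed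

lemma proj_eq_iff:
  assumes "x \<in> carrier G" "y \<in> carrier G"
  shows "proj x = proj y \<longleftrightarrow> x \<otimes> inv y \<in> N"
proof -
  have "inj_on \<iota> (carrier (G Mod N))"
    using quotient unfolding definable_quotient_def iso_def bij_betw_def by blast
  moreover have "N #> x \<in> carrier (G Mod N)" "N #> y \<in> carrier (G Mod N)"
    using assms subset by (auto simp: FactGroup_def intro: rcosetsI)
  ultimately have "proj x = proj y \<longleftrightarrow> N #> x = N #> y"
    unfolding quot_proj_def by (rule inj_on_eq_iff)
  also have "\<dots> \<longleftrightarrow> x \<in> N #> y"
    using repr_independence[OF _ assms(2) subgroup_axioms] rcos_self[OF assms(1) subgroup_axioms] by blast
  also have "\<dots> \<longleftrightarrow> x \<otimes> inv y \<in> N" using rcos_module[OF is_group assms(2,1)] .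
  finally show ?thesis .
qed

lemma proj_surj:
  assumes "c \<in> carrier Q"
  obtains b where "b \<in> carrier G" "proj b = c"
proof -
  have "\<iota> ` carrier (G Mod N) = carrier Q"
    using quotient unfolding definable_quotient_def iso_def bij_betw_def by blast
  then have "c \<in> \<iota> ` (rcosets N)" using assms by (simp add: FactGroup_def)
  then show thesis using that unfolding RCOSETS_def quot_proj_def by blast
qed

text \<open>Equivariance holds because the graph of the projection is definable over \<open>A\<close>.\<close>

lemma proj_act:
  assumes "\<sigma> \<in> Aut S A" "x \<in> carrier G"
  shows "proj (map \<sigma> x) = map \<sigma> (proj x)"
proof -
  have graph: "definable S A (n + k) {x @ proj x | x. x \<in> carrier G}"
    using quotient unfolding definable_quotient_def by blast
  have x: "x \<in> tuples n" using definable_group_tuples[OF G_definable assms(2)] .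
  have "proj x \<in> tuples k"
    using definable_group_tuples[OF Q_definable] group_hom.hom_closed[OF proj_hom assms(2)] by blast
  then have "length (x @ proj x) = n + k" using x by (simp add: tuples_def)
  then have "map \<sigma> (x @ proj x) \<in> {x @ proj x | x. x \<in> carrier G}"
    using definable_Aut[OF assms(1) graph] assms(2) by blast
  then obtain y where y: "map \<sigma> x @ map \<sigma> (proj x) = y @ proj y" "y \<in> carrier G" by auto
  then have "length (map \<sigma> x) = length y"
    using x definable_group_tuples[OF G_definable y(2)] by (simp add: tuples_def)
  then show ?thesis using y(1) by simp
qed

lemma Z1_val: "\<Phi> \<in> Z1 S A G map \<Longrightarrow> \<sigma> \<in> Aut S A \<Longrightarrow> \<Phi> \<sigma> \<in> carrier G"
  unfolding Z1_def by blast

lemma Z1_cocycle: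
  "\<Phi> \<in> Z1 S A G map \<Longrightarrow> \<sigma> \<in> Aut S A \<Longrightarrow> \<tau> \<in> Aut S A \<Longrightarrow> \<Phi> (\<sigma> \<circ> \<tau>) = \<Phi> \<sigma> \<otimes> map \<sigma> (\<Phi> \<tau>)"
  unfolding Z1_def by blast

lemma Z1_definable: "\<Phi> \<in> Z1 S A H act \<Longrightarrow> definable_cochain S A \<Phi>"
  unfolding Z1_def by blast

lemma Z1I:
  assumes "\<And>\<sigma>. \<sigma> \<in> Aut S A \<Longrightarrow> f \<sigma> \<in> carrier H"
    and "\<And>\<sigma> \<tau>. \<sigma> \<in> Aut S A \<Longrightarrow> \<tau> \<in> Aut S A \<Longrightarrow> f (\<sigma> \<circ> \<tau>) = f \<sigma> \<otimes>\<^bsub>H\<^esub> act \<sigma> (f \<tau>)"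
    and "definable_cochain S A f"
  shows "(\<lambda>\<sigma> \<in> Aut S A. f \<sigma>) \<in> Z1 S A H act"
proof -
  have "definable_cochain S A (\<lambda>\<sigma> \<in> Aut S A. f \<sigma>)"
    using assms(3) by (rule iffD2[OF definable_cochain_cong, rotated]) simp
  then show ?thesis using assms(1,2) unfolding Z1_def by (simp add: comp_Aut)
qed

lemma proj_cocycle:
  assumes \<Phi>: "\<Phi> \<in> Z1 S A G map"
  shows "(\<lambda>\<sigma> \<in> Aut S A. proj (\<Phi> \<sigma>)) \<in> Z1 S A Q map"
proof (rule Z1I)
  show "proj (\<Phi> \<sigma>) \<in> carrier Q" if "\<sigma> \<in> Aut S A" for \<sigma>
    using group_hom.hom_closed[OF proj_hom Z1_val[OF \<Phi> that]] .
  show "proj (\<Phi> (\<sigma> \<circ> \<tau>)) = proj (\<Phi> \<sigma>) \<otimes>\<^bsub>Q\<^esub> map \<sigma> (proj (\<Phi> \<tau>))"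
    if "\<sigma> \<in> Aut S A" "\<tau> \<in> Aut S A" for \<sigma> \<tau>
    using group_hom.hom_mult[OF proj_hom] Z1_cocycle[OF \<Phi> that] Z1_val[OF \<Phi>] that
    by (simp add: act_simps proj_act)
  have carr: "carrier G \<subseteq> tuples n" using definable_group_tuples[OF G_definable] by blast
  have graph: "definable S A (n + k) {x @ proj x | x. x \<in> carrier G}"
    using quotient unfolding definable_quotient_def by blast
  show "definable_cochain S A (\<lambda>\<sigma>. proj (\<Phi> \<sigma>))"
    by (rule definable_cochain_map[OF Z1_definable[OF \<Phi>] _ carr graph]) (rule Z1_val[OF \<Phi>])
qed

lemma proj_cohomologous:
  assumes "(\<Phi>, \<Psi>) \<in> cohomologous S A G map"
  shows "(\<lambda>\<sigma> \<in> Aut S A. proj (\<Phi> \<sigma>), \<lambda>\<sigma> \<in> Aut S A. proj (\<Psi> \<sigma>)) \<in> cohomologous S A Q map"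
proof -
  obtain b where Z: "\<Phi> \<in> Z1 S A G map" "\<Psi> \<in> Z1 S A G map" and b: "b \<in> carrier G"
    and eq: "\<And>\<sigma>. \<sigma> \<in> Aut S A \<Longrightarrow> \<Psi> \<sigma> = inv b \<otimes> \<Phi> \<sigma> \<otimes> map \<sigma> b"
    using assms unfolding cohomologous_def by blast
  have "proj (\<Psi> \<sigma>) = inv\<^bsub>Q\<^esub> (proj b) \<otimes>\<^bsub>Q\<^esub> proj (\<Phi> \<sigma>) \<otimes>\<^bsub>Q\<^esub> map \<sigma> (proj b)"
    if "\<sigma> \<in> Aut S A" for \<sigma>
    using eq[OF that] Z1_val[OF Z(1) that] b that
    by (simp add: group_hom.hom_mult[OF proj_hom] group_hom.hom_inv[OF proj_hom] act_simps proj_act)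
  then have "\<forall>\<sigma> \<in> Aut S A. (\<lambda>\<sigma> \<in> Aut S A. proj (\<Psi> \<sigma>)) \<sigma> =
      inv\<^bsub>Q\<^esub> (proj b) \<otimes>\<^bsub>Q\<^esub> (\<lambda>\<sigma> \<in> Aut S A. proj (\<Phi> \<sigma>)) \<sigma> \<otimes>\<^bsub>Q\<^esub> map \<sigma> (proj b)"
    by simp
  then show ?thesis
    using proj_cocycle[OF Z(1)] proj_cocycle[OF Z(2)] group_hom.hom_closed[OF proj_hom b]
    unfolding cohomologous_def by blast
qed

text \<open>The union that defines the induced map runs over the representatives of one class, whose images
  all have the same class.\<close>

lemma H1_map_class:
  assumes \<Phi>: "\<Phi> \<in> Z1 S A G map"
  shows "H1_map S A Q proj (coh_class S A G map \<Phi>) = coh_class S A Q map (\<lambda>\<sigma> \<in> Aut S A. proj (\<Phi> \<sigma>))"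
proof -
  have "coh_class S A Q map (\<lambda>\<sigma> \<in> Aut S A. proj (\<Psi> \<sigma>)) = coh_class S A Q map (\<lambda>\<sigma> \<in> Aut S A. proj (\<Phi> \<sigma>))"
    if "\<Psi> \<in> coh_class S A G map \<Phi>" for \<Psi>
    using equiv_class_eq[OF equiv_Q proj_cohomologous] that unfolding coh_class_def by blast
  moreover have "\<Phi> \<in> coh_class S A G map \<Phi>"
    unfolding coh_class_def using equiv_class_self[OF equiv_G \<Phi>] .
  ultimately show ?thesis unfolding H1_map_def by blast
qed

lemma group_subgroup_N: "group subgroup_N"
  using subgroup_is_group[OF is_group] .

text \<open>Normality of \<open>N\<close> is used here: conjugation by \<open>\<Phi> \<sigma>\<close> maps \<open>N\<close> to itself.\<close>

lemma twist_hom: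
  assumes \<Phi>: "\<Phi> \<in> Z1 S A G map" and \<sigma>: "\<sigma> \<in> Aut S A"
  shows "twist G \<Phi> \<sigma> \<in> hom subgroup_N subgroup_N"
proof -
  have "twist G \<Phi> \<sigma> x \<in> N" if "x \<in> N" for x
    unfolding twist_def using inv_op_closed2[OF Z1_val[OF assms] act_N[OF \<sigma> that]] .
  moreover have "twist G \<Phi> \<sigma> (x \<otimes> y) = twist G \<Phi> \<sigma> x \<otimes> twist G \<Phi> \<sigma> y" if "x \<in> N" "y \<in> N" for x y
    using that subset Z1_val[OF assms] act_simps[OF \<sigma>] unfolding twist_def
    by (simp add: m_assoc cancel_inv subsetD)
  ultimately show ?thesis unfolding hom_def by simp
qed

lemma equiv_twist:
  "\<Phi> \<in> Z1 S A G map \<Longrightarrow> equiv (Z1 S A subgroup_N (twist G \<Phi>)) (cohomologous S A subgroup_N (twist G \<Phi>))"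
  using group_subgroup_N twist_hom by (rule equiv_cohomologous)

lemma twisted_val:
  "\<Psi> \<in> Z1 S A subgroup_N act \<Longrightarrow> \<sigma> \<in> Aut S A \<Longrightarrow> \<Psi> \<sigma> \<in> N"
  unfolding Z1_def by fastforce

lemma twisted_val_carrier:
  "\<Psi> \<in> Z1 S A subgroup_N act \<Longrightarrow> \<sigma> \<in> Aut S A \<Longrightarrow> \<Psi> \<sigma> \<in> carrier G"
  using twisted_val subset by blast

abbreviation translate where "translate \<Phi> \<Psi> \<equiv> \<lambda>\<sigma> \<in> Aut S A. \<Psi> \<sigma> \<otimes> \<Phi> \<sigma>"

text \<open>With \<open>\<sigma> * x = \<Phi>(\<sigma>) \<sigma>(x) \<Phi>(\<sigma>)\<inverse>\<close> the twisted cocycle rule gives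
  \<open>\<Psi>(\<sigma>\<tau>) \<Phi>(\<sigma>\<tau>) = \<Psi>(\<sigma>) \<Phi>(\<sigma>) \<sigma>(\<Psi>(\<tau>)) \<Phi>(\<sigma>)\<inverse> \<cdot> \<Phi>(\<sigma>) \<sigma>(\<Phi>(\<tau>))\<close>, and the two inner factors cancel.\<close>

lemma translate_cocycle:
  assumes \<Phi>: "\<Phi> \<in> Z1 S A G map" and \<Psi>: "\<Psi> \<in> Z1 S A subgroup_N (twist G \<Phi>)"
  shows "translate \<Phi> \<Psi> \<in> Z1 S A G map"
proof (rule Z1I)
  note val = Z1_val[OF \<Phi>] twisted_val_carrier[OF \<Psi>]
  show "\<Psi> \<sigma> \<otimes> \<Phi> \<sigma> \<in> carrier G" if "\<sigma> \<in> Aut S A" for \<sigma>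
    using val[OF that] by simp
  show "\<Psi> (\<sigma> \<circ> \<tau>) \<otimes> \<Phi> (\<sigma> \<circ> \<tau>) = \<Psi> \<sigma> \<otimes> \<Phi> \<sigma> \<otimes> map \<sigma> (\<Psi> \<tau> \<otimes> \<Phi> \<tau>)"
    if "\<sigma> \<in> Aut S A" "\<tau> \<in> Aut S A" for \<sigma> \<tau>
  proof -
    have "\<Psi> (\<sigma> \<circ> \<tau>) = \<Psi> \<sigma> \<otimes> twist G \<Phi> \<sigma> (\<Psi> \<tau>)"
      using \<Psi> that unfolding Z1_def by simp
    then show ?thesis
      using Z1_cocycle[OF \<Phi> that] val[OF that(1)] val[OF that(2)] act_simps[OF that(1)]
      by (simp add: twist_def m_assoc cancel_inv)
  qed
  show "definable_cochain S A (\<lambda>\<sigma>. \<Psi> \<sigma> \<otimes> \<Phi> \<sigma>)"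
    by (rule definable_cochain_mult[OF G_definable Z1_definable[OF \<Psi>] Z1_definable[OF \<Phi>] val(2) val(1)])
qed

text \<open>The same element \<open>b \<in> N\<close> witnesses both relations, because \<open>(\<sigma> * b) \<Phi>(\<sigma>) = \<Phi>(\<sigma>) \<sigma>(b)\<close>.\<close>

lemma translate_cohomologous:
  assumes \<Phi>: "\<Phi> \<in> Z1 S A G map"
    and coh: "(\<Psi>, \<Lambda>) \<in> cohomologous S A subgroup_N (twist G \<Phi>)"
  shows "(translate \<Phi> \<Psi>, translate \<Phi> \<Lambda>) \<in> cohomologous S A G map"
proof -
  obtain b where \<Psi>: "\<Psi> \<in> Z1 S A subgroup_N (twist G \<Phi>)" and \<Lambda>: "\<Lambda> \<in> Z1 S A subgroup_N (twist G \<Phi>)"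
    and b: "b \<in> N"
    and eq: "\<And>\<sigma>. \<sigma> \<in> Aut S A \<Longrightarrow> \<Lambda> \<sigma> = inv\<^bsub>subgroup_N\<^esub> b \<otimes> \<Psi> \<sigma> \<otimes> twist G \<Phi> \<sigma> b"
    using coh unfolding cohomologous_def by auto
  have bG: "b \<in> carrier G" using b subset by blast
  have "\<Lambda> \<sigma> \<otimes> \<Phi> \<sigma> = inv b \<otimes> (\<Psi> \<sigma> \<otimes> \<Phi> \<sigma>) \<otimes> map \<sigma> b" if \<sigma>: "\<sigma> \<in> Aut S A" for \<sigma>
    using eq[OF \<sigma>] Z1_val[OF \<Phi> \<sigma>] twisted_val_carrier[OF \<Psi> \<sigma>] act_simps[OF \<sigma>] bG b
      m_inv_consistent[OF subgroup_axioms b]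
    by (simp add: twist_def m_assoc cancel_inv)
  then have "\<forall>\<sigma> \<in> Aut S A. translate \<Phi> \<Lambda> \<sigma> = inv b \<otimes> translate \<Phi> \<Psi> \<sigma> \<otimes> map \<sigma> b"
    by simp
  then show ?thesis
    using translate_cocycle[OF \<Phi> \<Psi>] translate_cocycle[OF \<Phi> \<Lambda>] bG unfolding cohomologous_def by blast
qed

lemma proj_translate:
  assumes \<Phi>: "\<Phi> \<in> Z1 S A G map" and \<Psi>: "\<Psi> \<in> Z1 S A subgroup_N (twist G \<Phi>)" and \<sigma>: "\<sigma> \<in> Aut S A"
  shows "proj (translate \<Phi> \<Psi> \<sigma>) = proj (\<Phi> \<sigma>)"
proof -
  have "\<Psi> \<sigma> \<otimes> \<Phi> \<sigma> \<otimes> inv (\<Phi> \<sigma>) = \<Psi> \<sigma>"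
    using Z1_val[OF \<Phi> \<sigma>] twisted_val_carrier[OF \<Psi> \<sigma>] by (simp add: m_assoc)
  then have "proj (\<Psi> \<sigma> \<otimes> \<Phi> \<sigma>) = proj (\<Phi> \<sigma>)"
    using proj_eq_iff[of "\<Psi> \<sigma> \<otimes> \<Phi> \<sigma>" "\<Phi> \<sigma>"] Z1_val[OF \<Phi> \<sigma>] twisted_val_carrier[OF \<Psi> \<sigma>]
      twisted_val[OF \<Psi> \<sigma>] by simp
  then show ?thesis using \<sigma> by simp
qed

text \<open>Surjectivity at the level of cocycles. After a change of \<open>\<Lambda>\<close> within its class, \<open>\<Lambda>\<close> and \<open>\<Phi>\<close> have the same
  projection, and then they differ by values in \<open>N\<close>.\<close>

lemma fibre_lift:
  assumes \<Phi>: "\<Phi> \<in> Z1 S A G map" and \<Lambda>: "\<Lambda> \<in> Z1 S A G map"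
    and coh: "(\<lambda>\<sigma> \<in> Aut S A. proj (\<Phi> \<sigma>), \<lambda>\<sigma> \<in> Aut S A. proj (\<Lambda> \<sigma>)) \<in> cohomologous S A Q map"
  obtains \<Psi> where "\<Psi> \<in> Z1 S A subgroup_N (twist G \<Phi>)" "(translate \<Phi> \<Psi>, \<Lambda>) \<in> cohomologous S A G map"
proof -
  interpret Q: group Q by (rule group_Q)
  interpret proj: group_hom G Q proj by (rule proj_hom)
  obtain c where c: "c \<in> carrier Q"
    and c_eq: "\<And>\<sigma>. \<sigma> \<in> Aut S A \<Longrightarrow> proj (\<Lambda> \<sigma>) = inv\<^bsub>Q\<^esub> c \<otimes>\<^bsub>Q\<^esub> proj (\<Phi> \<sigma>) \<otimes>\<^bsub>Q\<^esub> map \<sigma> c"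
    using coh unfolding cohomologous_def by auto
  obtain b where b: "b \<in> carrier G" "proj b = c" using proj_surj[OF c] .
  \<comment> \<open>The factor in front of \<open>inv (\<Phi> \<sigma>)\<close> is the representative of the class of \<open>\<Lambda>\<close> that projects to
    the same cocycle as \<open>\<Phi>\<close>.\<close>
  define f where "f \<sigma> = (b \<otimes> \<Lambda> \<sigma> \<otimes> inv (map \<sigma> b)) \<otimes> inv (\<Phi> \<sigma>)" for \<sigma>
  note val = Z1_val[OF \<Phi>] Z1_val[OF \<Lambda>]
  have f_N: "f \<sigma> \<in> N" if \<sigma>: "\<sigma> \<in> Aut S A" for \<sigma>
  proof -
    have [simp]: "map \<sigma> c \<in> carrier Q" using proj_act[OF \<sigma> b(1)] act_simps(1)[OF \<sigma> b(1)] b(2) proj.hom_closed by metis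
    have "proj (b \<otimes> \<Lambda> \<sigma> \<otimes> inv (map \<sigma> b)) = c \<otimes>\<^bsub>Q\<^esub> proj (\<Lambda> \<sigma>) \<otimes>\<^bsub>Q\<^esub> inv\<^bsub>Q\<^esub> (map \<sigma> c)"
      using b val[OF \<sigma>] act_simps[OF \<sigma>] proj_act[OF \<sigma> b(1)] by simp
    also have "\<dots> = proj (\<Phi> \<sigma>)"
      using c val[OF \<sigma>] c_eq[OF \<sigma>] by (simp add: Q.m_assoc Q.cancel_inv)
    finally have "proj (b \<otimes> \<Lambda> \<sigma> \<otimes> inv (map \<sigma> b)) = proj (\<Phi> \<sigma>)" .
    moreover have "b \<otimes> \<Lambda> \<sigma> \<otimes> inv (map \<sigma> b) \<in> carrier G"
      using b(1) val[OF \<sigma>] act_simps(1)[OF \<sigma>] by simp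
    ultimately show ?thesis
      unfolding f_def using proj_eq_iff[OF _ val(1)[OF \<sigma>]] by blast
  qed
  have f_\<Phi>: "f \<sigma> \<otimes> \<Phi> \<sigma> = b \<otimes> \<Lambda> \<sigma> \<otimes> inv (map \<sigma> b)" if "\<sigma> \<in> Aut S A" for \<sigma>
    unfolding f_def using b(1) val[OF that] act_simps[OF that] by (simp add: m_assoc)
  let ?\<Psi> = "\<lambda>\<sigma> \<in> Aut S A. f \<sigma>"
  have "?\<Psi> \<in> Z1 S A subgroup_N (twist G \<Phi>)"
  proof (rule Z1I)
    show "f (\<sigma> \<circ> \<tau>) = f \<sigma> \<otimes>\<^bsub>subgroup_N\<^esub> twist G \<Phi> \<sigma> (f \<tau>)"
      if "\<sigma> \<in> Aut S A" "\<tau> \<in> Aut S A" for \<sigma> \<tau>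
    proof -
      have "map (\<sigma> \<circ> \<tau>) b = map \<sigma> (map \<tau> b)" by simp
      then show ?thesis
        using Z1_cocycle[OF \<Phi> that] Z1_cocycle[OF \<Lambda> that] val[OF that(1)] val[OF that(2)]
          act_simps[OF that(1)] act_simps[OF that(2)] b(1)
        unfolding f_def twist_def by (simp add: m_assoc inv_mult_group cancel_inv del: map_map)
    qed
    have 1: "definable_cochain S A (\<lambda>\<sigma>. b \<otimes> \<Lambda> \<sigma>)"
      by (rule definable_cochain_mult[OF G_definable definable_cochain_const Z1_definable[OF \<Lambda>] b(1) val(2)])
    have 2: "definable_cochain S A (\<lambda>\<sigma>. b \<otimes> \<Lambda> \<sigma> \<otimes> inv (map \<sigma> b))"
      by (rule definable_cochain_divide[OF G_definable 1 definable_cochain_orbit])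
        (simp_all add: b(1) val(2) act_simps(1))
    show "definable_cochain S A f"
      unfolding f_def[abs_def]
      by (rule definable_cochain_divide[OF G_definable 2 Z1_definable[OF \<Phi>]])
        (simp_all add: b(1) val act_simps(1))
  qed (simp add: f_N)
  moreover from this have "(translate \<Phi> ?\<Psi>, \<Lambda>) \<in> cohomologous S A G map"
  proof -
    have "\<Lambda> \<sigma> = inv b \<otimes> translate \<Phi> ?\<Psi> \<sigma> \<otimes> map \<sigma> b" if "\<sigma> \<in> Aut S A" for \<sigma>
      using f_\<Phi>[OF that] b(1) val[OF that] act_simps[OF that] that by (simp add: m_assoc cancel_inv)
    then show ?thesis
      using translate_cocycle[OF \<Phi> \<open>?\<Psi> \<in> _\<close>] \<Lambda> b(1) unfolding cohomologous_def by blast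
  qed
  ultimately show thesis by (rule that)
qed

text \<open>The function on classes is the union of the images of the representatives; by
  \<open>translate_cohomologous\<close> it is a union of equal classes.\<close>

lemma fibre_parametrisation:
  assumes \<mu>: "\<mu> \<in> H1 S A G map" and "\<Phi> \<in> \<mu>"
  defines "H \<equiv> H1 S A subgroup_N (twist G \<Phi>)"
    and "fib \<equiv> H1_fibre S A G Q proj \<mu>"
  shows "\<exists>F. pointed_morphism H (trivial_class S A subgroup_N (twist G \<Phi>)) fib \<mu> F
      \<and> F ` H = fib
      \<and> (\<forall>\<Psi> \<in> Z1 S A subgroup_N (twist G \<Phi>).
           F (coh_class S A subgroup_N (twist G \<Phi>) \<Psi>) = coh_class S A G map (translate \<Phi> \<Psi>))"
proof -
  have \<Phi>: "\<Phi> \<in> Z1 S A G map" and \<mu>_eq: "\<mu> = coh_class S A G map \<Phi>"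
    using H1_memD[OF equiv_G \<mu> \<open>\<Phi> \<in> \<mu>\<close>] .
  let ?Z = "Z1 S A subgroup_N (twist G \<Phi>)"
  let ?cl = "coh_class S A subgroup_N (twist G \<Phi>)"
  define F where "F \<kappa> = (\<Union>\<Psi> \<in> \<kappa>. coh_class S A G map (translate \<Phi> \<Psi>))" for \<kappa>
  have F: "F (?cl \<Psi>) = coh_class S A G map (translate \<Phi> \<Psi>)" if "\<Psi> \<in> ?Z" for \<Psi>
  proof -
    have "coh_class S A G map (translate \<Phi> \<Lambda>) = coh_class S A G map (translate \<Phi> \<Psi>)" if "\<Lambda> \<in> ?cl \<Psi>" for \<Lambda>
      using equiv_class_eq[OF equiv_G translate_cohomologous[OF \<Phi>]] that unfolding coh_class_def by blast
    moreover have "\<Psi> \<in> ?cl \<Psi>"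
      unfolding coh_class_def using equiv_class_self[OF equiv_twist[OF \<Phi>] that] .
    ultimately show ?thesis unfolding F_def by blast
  qed
  have H: "\<exists>\<Psi> \<in> ?Z. \<kappa> = ?cl \<Psi>" if "\<kappa> \<in> H" for \<kappa>
    using that unfolding H_def H1_def coh_class_def quotient_def by blast
  have fib: "coh_class S A G map (translate \<Phi> \<Psi>) \<in> fib" if "\<Psi> \<in> ?Z" for \<Psi>
  proof -
    have "(\<lambda>\<sigma> \<in> Aut S A. proj (translate \<Phi> \<Psi> \<sigma>)) = (\<lambda>\<sigma> \<in> Aut S A. proj (\<Phi> \<sigma>))"
      using proj_translate[OF \<Phi> that] by (rule restrict_ext)
    then show ?thesis
      unfolding fib_def H1_fibre_def \<mu>_eq
      using H1_map_class[OF translate_cocycle[OF \<Phi> that]] H1_map_class[OF \<Phi>]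
        coh_class_in_H1[OF translate_cocycle[OF \<Phi> that]] by simp
  qed
  have "\<nu> \<in> F ` H" if "\<nu> \<in> fib" for \<nu>
  proof -
    have \<nu>: "\<nu> \<in> H1 S A G map" "H1_map S A Q proj \<nu> = H1_map S A Q proj \<mu>"
      using that unfolding fib_def H1_fibre_def by blast+
    obtain \<Lambda> where \<Lambda>: "\<Lambda> \<in> Z1 S A G map" "\<nu> = coh_class S A G map \<Lambda>"
      using \<nu>(1) unfolding H1_def coh_class_def by (elim quotientE)
    have "coh_class S A Q map (\<lambda>\<sigma> \<in> Aut S A. proj (\<Phi> \<sigma>)) = coh_class S A Q map (\<lambda>\<sigma> \<in> Aut S A. proj (\<Lambda> \<sigma>))"
      using \<nu>(2) H1_map_class \<Phi> \<Lambda> \<mu>_eq by simp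
    then have "(\<lambda>\<sigma> \<in> Aut S A. proj (\<Phi> \<sigma>), \<lambda>\<sigma> \<in> Aut S A. proj (\<Lambda> \<sigma>)) \<in> cohomologous S A Q map"
      using coh_class_eq_iff[OF equiv_Q proj_cocycle[OF \<Phi>] proj_cocycle[OF \<Lambda>(1)]] by blast
    then obtain \<Psi> where \<Psi>: "\<Psi> \<in> ?Z" "(translate \<Phi> \<Psi>, \<Lambda>) \<in> cohomologous S A G map"
      using fibre_lift[OF \<Phi> \<Lambda>(1)] by blast
    have "F (?cl \<Psi>) = \<nu>"
      using F[OF \<Psi>(1)] equiv_class_eq[OF equiv_G \<Psi>(2)] \<Lambda>(2) by (simp add: coh_class_def)
    moreover have "?cl \<Psi> \<in> H" unfolding H_def using coh_class_in_H1[OF \<Psi>(1)] .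
    ultimately show ?thesis by blast
  qed
  moreover have F_fib: "F \<kappa> \<in> fib" if "\<kappa> \<in> H" for \<kappa>
    using H[OF that] F fib by auto
  ultimately have "F ` H = fib" by blast
  moreover have "pointed_morphism H (trivial_class S A subgroup_N (twist G \<Phi>)) fib \<mu> F"
  proof -
    have one: "(\<lambda>\<sigma> \<in> Aut S A. \<one>\<^bsub>subgroup_N\<^esub>) \<in> ?Z"
      using group_subgroup_N twist_hom[OF \<Phi>] by (rule trivial_cocycle)
    have "translate \<Phi> (\<lambda>\<sigma> \<in> Aut S A. \<one>\<^bsub>subgroup_N\<^esub>) \<sigma> = \<Phi> \<sigma>" for \<sigma>
    proof (cases "\<sigma> \<in> Aut S A")
      case True
      then show ?thesis using Z1_val[OF \<Phi> True] by simp
    next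
      case False
      have "\<Phi> \<in> Aut S A \<rightarrow>\<^sub>E carrier G" using \<Phi> unfolding Z1_def by blast
      then have "\<Phi> \<sigma> = undefined" using False by (rule PiE_arb)
      then show ?thesis using False by simp
    qed
    then have tr: "translate \<Phi> (\<lambda>\<sigma> \<in> Aut S A. \<one>\<^bsub>subgroup_N\<^esub>) = \<Phi>" by blast
    have "F (trivial_class S A subgroup_N (twist G \<Phi>)) = \<mu>"
      unfolding trivial_class_def F[OF one] tr \<mu>_eq ..
    moreover have "trivial_class S A subgroup_N (twist G \<Phi>) \<in> H"
      unfolding trivial_class_def H_def using coh_class_in_H1[OF one] .
    moreover have "\<mu> \<in> fib" unfolding fib_def H1_fibre_def using \<mu> by simp
    ultimately show ?thesis using F_fib unfolding pointed_morphism_def by blast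
  qed
  ultimately show ?thesis using F by blast
qed

end

theorem lemma4p1:
  fixes S :: "('f, 'r, 'm) fo_struct" and A :: "'m set"
    and n :: nat and G :: "'m list monoid" and N :: "'m list set"
  assumes "atomic_over S A"
    and "homogeneous_over S A"
    and "eliminates_imaginaries S"
    and "definable_group S A n G"
    and "definable S A n N"
    and "N \<lhd> G"
  shows "(\<exists>k Q \<iota>. definable_quotient S A n G N k Q \<iota>)
    \<and> (\<forall>k Q \<iota>. definable_quotient S A n G N k Q \<iota> \<longrightarrow>
        (\<forall>\<mu> \<in> H1 S A G map. \<forall>\<Phi> \<in> \<mu>.
          let N' = G\<lparr>carrier := N\<rparr>;
              tw = twist G \<Phi>;
              fib = H1_fibre S A G Q (quot_proj G N \<iota>) \<mu>
          in \<exists>F. pointed_morphism (H1 S A N' tw) (trivial_class S A N' tw) fib \<mu> F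
               \<and> F ` H1 S A N' tw = fib
               \<and> (\<forall>\<Psi> \<in> Z1 S A N' tw.
                    F (coh_class S A N' tw \<Psi>)
                      = coh_class S A G map (\<lambda>\<sigma> \<in> Aut S A. \<Psi> \<sigma> \<otimes>\<^bsub>G\<^esub> \<Phi> \<sigma>))))"
proof (intro conjI allI impI ballI)
  show "\<exists>k Q \<iota>. definable_quotient S A n G N k Q \<iota>"
    using definable_quotient_exists[OF assms(3-6)] by blast
next
  fix k Q \<iota> \<mu> \<Phi>
  assume Q: "definable_quotient S A n G N k Q \<iota>" and \<mu>: "\<mu> \<in> H1 S A G map" "\<Phi> \<in> \<mu>"
  interpret definable_extension N G S A n k Q \<iota>
    using assms(4-6) Q by (intro definable_extension.intro definable_extension_axioms.intro)
  show "let N' = G\<lparr>carrier := N\<rparr>;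
              tw = twist G \<Phi>;
              fib = H1_fibre S A G Q (quot_proj G N \<iota>) \<mu>
          in \<exists>F. pointed_morphism (H1 S A N' tw) (trivial_class S A N' tw) fib \<mu> F
               \<and> F ` H1 S A N' tw = fib
               \<and> (\<forall>\<Psi> \<in> Z1 S A N' tw.
                    F (coh_class S A N' tw \<Psi>)
                      = coh_class S A G map (\<lambda>\<sigma> \<in> Aut S A. \<Psi> \<sigma> \<otimes>\<^bsub>G\<^esub> \<Phi> \<sigma>))"
    unfolding Let_def using fibre_parametrisation[OF \<mu>] .
qed

end
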